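(* Let $A$ be an irreducible affine Cartan matrix which is not of type $B_n^{(1)}, C_n^{(1)}, F_4^{(1)}, G_2^{(1)}$, let $\mathcal A$ be the associated triple group, and let $\Upsilon:B_3\to\mathrm{Aut}(\mathcal A)$ be the group morphism $\mathfrak a\mapsto \underline{\mathfrak a}$, $\mathfrak b\mapsto\underline{\mathfrak b}$. Then $\Upsilon$ is injective.
   Context: $A=(a_{jk})_{0\le j,k\le n}$ is an irreducible affine Cartan matrix, labelled as in Kac's book, node $0$ being the affine node; types $B_n^{(1)}, C_n^{(1)}, F_4^{(1)}, G_2^{(1)}$ are excluded. In the Dynkin diagram $S(A)$ distinct nodes $i,j$ are connected by $a_{ij}a_{ji}$ laces. The braid relation between elements $x,y$ attached to distinct nodes $i,j$ is $xyx\cdots=yxy\cdots$ with $m_{ij}$ factors on each side, $m_{ij}=2,3,4,6$ if the nodes are connected by $0,1,2,3$ laces (no relation for $4$ laces, which happens only when $n=1$). The single lace Coxeter relation between $x$ and $y$ is $xyx=yxy$. The triple group $\mathcal A$ is the group with generators $\mathcal T_i$, one for each node $i\ne 0$, and three generators $\mathcal T_{01},\mathcal T_{02},\mathcal T_{03}$ attached to the affine node $0$; put $\mathcal D=\mathcal T_{01}\mathcal T_{02}\mathcal T_{03}$. The relations are: a) the braid relation for each pair of generators attached to two distinct nodes (no such relation among the $\mathcal T_{0i}$); b) if the affine node is connected with a node $\alpha$ by a single lace, then each of $\mathcal T_{01}$, $\mathcal T_{02}$, $\mathcal T_{03}$, $\mathcal T_{01}\mathcal T_{02}\mathcal T_{01}^{-1}$,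 $\mathcal T_{03}^{-1}\mathcal T_{02}\mathcal T_{03}$ satisfies the single lace Coxeter relation with $\mathcal D^k\mathcal T_\alpha\mathcal D^{-k}$ for all $k\in\mathbb Z$ (imposed for every such node $\alpha$); c) if the affine node is connected with a node $\alpha$ by two laces, then $\mathcal T_{0i}\mathcal T_\alpha^{-1}\mathcal T_{0j}\mathcal T_\alpha=\mathcal T_\alpha^{-1}\mathcal T_{0j}\mathcal T_\alpha\mathcal T_{0i}$ for all $1\le i<j\le 3$. $B_3=\langle \mathfrak a,\mathfrak b\mid \mathfrak a\mathfrak b\mathfrak a=\mathfrak b\mathfrak a\mathfrak b\rangle$ is the braid group on three letters. The automorphisms $\underline{\mathfrak a},\underline{\mathfrak b}$ of $\mathcal A$ fix all $\mathcal T_i$, $i\ne0$, and are given by $\underline{\mathfrak a}:\mathcal T_{03}\mapsto \mathcal T_{03},\ \mathcal T_{01}\mapsto \mathcal T_{02},\ \mathcal T_{02}\mapsto \mathcal T_{02}^{-1}\mathcal T_{01}\mathcal T_{02}$ and $\underline{\mathfrak b}:\mathcal T_{01}\mapsto \mathcal T_{01},\ \mathcal T_{02}\mapsto \mathcal T_{03},\ \mathcal T_{03}\mapsto \mathcal T_{03}^{-1}\mathcal T_{02}\mathcal T_{03}$; it is known that these are well-defined automorphisms and that $\Upsilon$ is a group morphism. *)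

theory Defs
  imports Complex_Main "HOL-Algebra.Bij"
begin

section \<open>Groups given by generators and relations\<close>

text \<open>A word is a list of letters \<open>(x, e)\<close>, where \<open>(x, True)\<close> stands for the generator \<open>x\<close> and
  \<open>(x, False)\<close> for its formal inverse.\<close>

type_synonym 'g word = "('g \<times> bool) list"

definition words :: "'g set \<Rightarrow> 'g word set" where
  "words S = lists (S \<times> UNIV)"

definition gen :: "'g \<Rightarrow> 'g word" where
  "gen x = [(x, True)]"

definition winv :: "'g word \<Rightarrow> 'g word" where
  "winv w = rev (map (\<lambda>(x, e). (x, \<not> e)) w)"

definition wpow :: "'g word \<Rightarrow> int \<Rightarrow> 'g word" where
  "wpow w k = (if 0 \<le> k then concat (replicate (nat k) w) else concat (replicate (nat (- k)) (winv w)))"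

text \<open>The congruence on words generated by free cancellation and by the relations \<open>l = r\<close>
  for \<open>(l, r) \<in> R\<close>.\<close>

inductive_set word_rel :: "'g set \<Rightarrow> ('g word \<times> 'g word) set \<Rightarrow> ('g word \<times> 'g word) set"
  for S :: "'g set" and R :: "('g word \<times> 'g word) set" where
  refl: "w \<in> words S \<Longrightarrow> (w, w) \<in> word_rel S R"
| sym: "(v, w) \<in> word_rel S R \<Longrightarrow> (w, v) \<in> word_rel S R"
| trans: "(u, v) \<in> word_rel S R \<Longrightarrow> (v, w) \<in> word_rel S R \<Longrightarrow> (u, w) \<in> word_rel S R"
| cancel: "x \<in> S \<Longrightarrow> u \<in> words S \<Longrightarrow> v \<in> words S \<Longrightarrow> (u @ [(x, e), (x, \<not> e)] @ v, u @ v) \<in> word_rel S R"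
| rel: "(l, r) \<in> R \<Longrightarrow> u \<in> words S \<Longrightarrow> v \<in> words S \<Longrightarrow> (u @ l @ v, u @ r @ v) \<in> word_rel S R"

definition presented_group :: "'g set \<Rightarrow> ('g word \<times> 'g word) set \<Rightarrow> 'g word set monoid" where
  "presented_group S R =
     \<lparr>carrier = words S // word_rel S R,
      mult = (\<lambda>C D. \<Union>u\<in>C. \<Union>v\<in>D. word_rel S R `` {u @ v}),
      one = word_rel S R `` {[]}\<rparr>"

definition pgen :: "'g set \<Rightarrow> ('g word \<times> 'g word) set \<Rightarrow> 'g \<Rightarrow> 'g word set" where
  "pgen S R x = word_rel S R `` {gen x}"

lemma words_simps [simp]:
  "[] \<in> words S"
  "(p # w) \<in> words S \<longleftrightarrow> fst p \<in> S \<and> w \<in> words S"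
  "v @ w \<in> words S \<longleftrightarrow> v \<in> words S \<and> w \<in> words S"
  by (auto simp: words_def mem_Times_iff)

lemma gen_in_words [simp]: "gen x \<in> words S \<longleftrightarrow> x \<in> S"
  by (simp add: gen_def)

lemma winv_in_words [simp]: "winv w \<in> words S \<longleftrightarrow> w \<in> words S"
  by (force simp: winv_def words_def in_lists_conv_set)

lemma concat_replicate_in_words: "w \<in> words S \<Longrightarrow> concat (replicate n w) \<in> words S"
  by (induction n) auto

lemma wpow_in_words: "w \<in> words S \<Longrightarrow> wpow w k \<in> words S"
  by (simp add: wpow_def concat_replicate_in_words)

context
  fixes S :: "'g set" and R :: "('g word \<times> 'g word) set"
  assumes R: "R \<subseteq> words S \<times> words S"
begin

lemma word_rel_in_words: "(v, w) \<in> word_rel S R \<Longrightarrow> v \<in> words S \<and> w \<in> words S"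
  by (induction rule: word_rel.induct) (use R in auto)

lemma equiv_word_rel: "equiv (words S) (word_rel S R)"
  by (intro equivI refl_onI symI transI)
    (auto intro: word_rel.intros dest: word_rel_in_words)

lemma word_rel_ctx:
  "(v, w) \<in> word_rel S R \<Longrightarrow> a \<in> words S \<Longrightarrow> b \<in> words S \<Longrightarrow> (a @ v @ b, a @ w @ b) \<in> word_rel S R"
proof (induction rule: word_rel.induct)
  case (cancel x u v e)
  then show ?case
    using word_rel.cancel[of x S "a @ u" "v @ b" e R] by simp
next
  case (rel l r u v)
  then show ?case
    using word_rel.rel[of l r R "a @ u" S "v @ b"] by simp
qed (auto intro: word_rel.intros)

lemma word_rel_append:
  assumes "(u, u') \<in> word_rel S R" "(v, v') \<in> word_rel S R"
  shows "(u @ v, u' @ v') \<in> word_rel S R"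
  using word_rel_ctx[OF assms(1), of "[]" v] word_rel_ctx[OF assms(2), of u' "[]"] assms
  by (auto dest: word_rel_in_words intro: word_rel.trans)

lemma mult_presented_group:
  assumes "u \<in> words S" "v \<in> words S"
  shows "word_rel S R `` {u} \<otimes>\<^bsub>presented_group S R\<^esub> word_rel S R `` {v} = word_rel S R `` {u @ v}"
proof -
  have "congruent2 (word_rel S R) (word_rel S R) (\<lambda>u v. word_rel S R `` {u @ v})"
    by (rule congruent2I') (rule equiv_class_eq[OF equiv_word_rel word_rel_append])
  then show ?thesis
    using UN_equiv_class2[OF equiv_word_rel equiv_word_rel _ assms]
    by (simp add: presented_group_def)
qed

lemma word_rel_winv: "w \<in> words S \<Longrightarrow> (winv w @ w, []) \<in> word_rel S R"
proof (induction w)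
  case Nil
  then show ?case by (simp add: winv_def word_rel.refl)
next
  case (Cons p w)
  obtain x e where p: "p = (x, e)" by force
  have "(winv w @ [(x, \<not> e), (x, \<not> \<not> e)] @ w, winv w @ w) \<in> word_rel S R"
    using Cons p by (intro word_rel.cancel) auto
  moreover have "winv (p # w) @ p # w = winv w @ [(x, \<not> e), (x, \<not> \<not> e)] @ w"
    by (simp add: winv_def p)
  ultimately show ?case
    using Cons by (auto intro: word_rel.trans)
qed

lemma group_presented_group: "group (presented_group S R)"
proof (rule groupI)
  show "\<one>\<^bsub>presented_group S R\<^esub> \<in> carrier (presented_group S R)"
    by (auto simp: presented_group_def intro: quotientI)
next
  fix C assume "C \<in> carrier (presented_group S R)"
  then obtain w where w: "w \<in> words S" "C = word_rel S R `` {w}"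
    by (auto simp: presented_group_def elim: quotientE)
  have one: "\<one>\<^bsub>presented_group S R\<^esub> = word_rel S R `` {[]}"
    by (simp add: presented_group_def)
  show "\<one>\<^bsub>presented_group S R\<^esub> \<otimes>\<^bsub>presented_group S R\<^esub> C = C"
    using w by (simp add: one mult_presented_group)
  have "word_rel S R `` {winv w} \<in> carrier (presented_group S R)"
    using w by (auto simp: presented_group_def intro: quotientI)
  moreover have "word_rel S R `` {winv w} \<otimes>\<^bsub>presented_group S R\<^esub> C = \<one>\<^bsub>presented_group S R\<^esub>"
    using w word_rel_winv[of w]
    by (simp add: one mult_presented_group equiv_class_eq[OF equiv_word_rel])
  ultimately show "\<exists>D\<in>carrier (presented_group S R). D \<otimes>\<^bsub>presented_group S R\<^esub> C = \<one>\<^bsub>presented_group S R\<^esub>"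
    by blast
next
  fix C D assume "C \<in> carrier (presented_group S R)" "D \<in> carrier (presented_group S R)"
  then obtain v w where "v \<in> words S" "C = word_rel S R `` {v}" "w \<in> words S" "D = word_rel S R `` {w}"
    by (auto simp: presented_group_def elim!: quotientE)
  then show "C \<otimes>\<^bsub>presented_group S R\<^esub> D \<in> carrier (presented_group S R)"
    by (simp add: mult_presented_group) (simp add: presented_group_def quotientI)
next
  fix C D E
  assume "C \<in> carrier (presented_group S R)" "D \<in> carrier (presented_group S R)"
    "E \<in> carrier (presented_group S R)"
  then obtain u v w where "u \<in> words S" "C = word_rel S R `` {u}" "v \<in> words S" "D = word_rel S R `` {v}"
    "w \<in> words S" "E = word_rel S R `` {w}"
    by (auto simp: presented_group_def elim!: quotientE)
  then show "C \<otimes>\<^bsub>presented_group S R\<^esub> D \<otimes>\<^bsub>presented_group S R\<^esub> E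
      = C \<otimes>\<^bsub>presented_group S R\<^esub> (D \<otimes>\<^bsub>presented_group S R\<^esub> E)"
    by (simp add: mult_presented_group)
qed

end


section \<open>Irreducible affine Cartan matrices\<close>

text \<open>Matrices are indexed by \<open>{0..n}\<close>; entries outside that range are irrelevant.\<close>

definition generalized_cartan_matrix :: "nat \<Rightarrow> (nat \<Rightarrow> nat \<Rightarrow> int) \<Rightarrow> bool" where
  "generalized_cartan_matrix n A \<longleftrightarrow>
     (\<forall>i\<le>n. A i i = 2) \<and>
     (\<forall>i\<le>n. \<forall>j\<le>n. i \<noteq> j \<longrightarrow> A i j \<le> 0) \<and>
     (\<forall>i\<le>n. \<forall>j\<le>n. A i j = 0 \<longrightarrow> A j i = 0)"

definition indecomposable_matrix :: "nat \<Rightarrow> (nat \<Rightarrow> nat \<Rightarrow> int) \<Rightarrow> bool" where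
  "indecomposable_matrix n A \<longleftrightarrow>
     (\<forall>I. I \<subseteq> {0..n} \<and> I \<noteq> {} \<and> I \<noteq> {0..n} \<longrightarrow> (\<exists>i\<in>I. \<exists>j\<in>{0..n} - I. A i j \<noteq> 0 \<or> A j i \<noteq> 0))"

definition mat_apply :: "nat \<Rightarrow> (nat \<Rightarrow> nat \<Rightarrow> int) \<Rightarrow> (nat \<Rightarrow> real) \<Rightarrow> nat \<Rightarrow> real" where
  "mat_apply n A v i = (\<Sum>j\<le>n. of_int (A i j) * v j)"

text \<open>The class (Aff) of Kac's trichotomy: corank one, with a strictly positive null vector, and
  \<open>A v \<ge> 0\<close> implies \<open>A v = 0\<close>. Given the null vector \<open>u\<close>, corank one says that \<open>u\<close> spans the kernel.\<close>

definition affine_type_matrix :: "nat \<Rightarrow> (nat \<Rightarrow> nat \<Rightarrow> int) \<Rightarrow> bool" where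
  "affine_type_matrix n A \<longleftrightarrow>
     (\<exists>u. (\<forall>i\<le>n. u i > 0) \<and> (\<forall>i\<le>n. mat_apply n A u i = 0) \<and>
          (\<forall>v. (\<forall>i\<le>n. mat_apply n A v i = 0) \<longrightarrow> (\<exists>c. \<forall>i\<le>n. v i = c * u i))) \<and>
     (\<forall>v. (\<forall>i\<le>n. mat_apply n A v i \<ge> 0) \<longrightarrow> (\<forall>i\<le>n. mat_apply n A v i = 0))"

definition irreducible_affine_cartan_matrix :: "nat \<Rightarrow> (nat \<Rightarrow> nat \<Rightarrow> int) \<Rightarrow> bool" where
  "irreducible_affine_cartan_matrix n A \<longleftrightarrow>
     generalized_cartan_matrix n A \<and> indecomposable_matrix n A \<and> affine_type_matrix n A"

text \<open>The types and node labels of Tables Aff 1, Aff 2 and Aff 3 of Kac's book.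
  \<open>A2_even l\<close>, \<open>A2_odd l\<close> and \<open>D2 l\<close> stand for the types A, A, D with lower indices
  \<open>2 * l\<close>, \<open>2 * l - 1\<close>, \<open>l + 1\<close> and upper index 2; in all cases but the numbered
  exceptional ones the argument is the index of the last node.\<close>

datatype affine_type =
    A1 nat | B1 nat | C1 nat | D1 nat | E6_1 | E7_1 | E8_1 | F4_1 | G2_1
  | A2_even nat | A2_odd nat | D2 nat | E6_2
  | D4_3

fun valid_type :: "affine_type \<Rightarrow> bool" where
  "valid_type (A1 l) = (l \<ge> 1)"
| "valid_type (B1 l) = (l \<ge> 3)"
| "valid_type (C1 l) = (l \<ge> 2)"
| "valid_type (D1 l) = (l \<ge> 4)"
| "valid_type (A2_even l) = (l \<ge> 1)"
| "valid_type (A2_odd l) = (l \<ge> 3)"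
| "valid_type (D2 l) = (l \<ge> 2)"
| "valid_type _ = True"

fun last_node :: "affine_type \<Rightarrow> nat" where
  "last_node (A1 l) = l"
| "last_node (B1 l) = l"
| "last_node (C1 l) = l"
| "last_node (D1 l) = l"
| "last_node E6_1 = 6"
| "last_node E7_1 = 7"
| "last_node E8_1 = 8"
| "last_node F4_1 = 4"
| "last_node G2_1 = 2"
| "last_node (A2_even l) = l"
| "last_node (A2_odd l) = l"
| "last_node (D2 l) = l"
| "last_node E6_2 = 4"
| "last_node D4_3 = 2"

text \<open>An edge \<open>(i, j, p, q)\<close> of the Dynkin diagram records the entries \<open>A i j = p\<close> and \<open>A j i = q\<close>;
  Kac's arrow points to \<open>i\<close> if \<open>\<bar>p\<bar> > 1\<close> and to \<open>j\<close> if \<open>\<bar>q\<bar> > 1\<close>.\<close>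

type_synonym edge = "nat \<times> nat \<times> int \<times> int"

definition single :: "nat \<Rightarrow> nat \<Rightarrow> edge" where
  "single i j = (i, j, -1, -1)"

definition chain :: "nat \<Rightarrow> nat \<Rightarrow> edge list" where
  "chain i j = map (\<lambda>k. single k (Suc k)) [i..<j]"

fun edges :: "affine_type \<Rightarrow> edge list" where
  "edges (A1 l) = (if l = 1 then [(0, 1, -2, -2)] else chain 0 l @ [single l 0])"
| "edges (B1 l) = single 0 2 # chain 1 (l - 1) @ [(l - 1, l, -1, -2)]"
| "edges (C1 l) = (0, 1, -1, -2) # chain 1 (l - 1) @ [(l - 1, l, -2, -1)]"
| "edges (D1 l) = single 0 2 # chain 1 (l - 1) @ [single (l - 2) l]"
| "edges E6_1 = chain 1 5 @ [single 3 6, single 6 0]"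
| "edges E7_1 = chain 0 6 @ [single 3 7]"
| "edges E8_1 = chain 0 7 @ [single 5 8]"
| "edges F4_1 = chain 0 2 @ [(2, 3, -1, -2)] @ chain 3 4"
| "edges G2_1 = [single 0 1, (1, 2, -1, -3)]"
| "edges (A2_even l) =
     (if l = 1 then [(0, 1, -4, -1)] else (0, 1, -2, -1) # chain 1 (l - 1) @ [(l - 1, l, -2, -1)])"
| "edges (A2_odd l) = single 0 2 # chain 1 (l - 1) @ [(l - 1, l, -2, -1)]"
| "edges (D2 l) = (0, 1, -2, -1) # chain 1 (l - 1) @ [(l - 1, l, -1, -2)]"
| "edges E6_2 = chain 0 2 @ [(2, 3, -2, -1)] @ chain 3 4"
| "edges D4_3 = [single 0 1, (1, 2, -3, -1)]"

definition kac_matrix :: "affine_type \<Rightarrow> nat \<Rightarrow> nat \<Rightarrow> int" where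
  "kac_matrix X i j =
     (if i = j then 2
      else (\<Sum>(a, b, p, q)\<leftarrow>edges X. if (i, j) = (a, b) then p else if (i, j) = (b, a) then q else 0))"

definition kac_labelled :: "nat \<Rightarrow> (nat \<Rightarrow> nat \<Rightarrow> int) \<Rightarrow> affine_type \<Rightarrow> bool" where
  "kac_labelled n A X \<longleftrightarrow>
     valid_type X \<and> n = last_node X \<and> (\<forall>i\<le>n. \<forall>j\<le>n. A i j = kac_matrix X i j)"


section \<open>The triple group\<close>

text \<open>\<open>T i\<close> is attached to the node \<open>i \<noteq> 0\<close>, and \<open>T0 1\<close>, \<open>T0 2\<close>, \<open>T0 3\<close> to the affine node.\<close>

datatype triple_gen = T nat | T0 nat

fun node :: "triple_gen \<Rightarrow> nat" where
  "node (T i) = i"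
| "node (T0 _) = 0"

definition triple_gens :: "nat \<Rightarrow> triple_gen set" where
  "triple_gens n = T ` {1..n} \<union> T0 ` {1, 2, 3}"

definition laces :: "(nat \<Rightarrow> nat \<Rightarrow> int) \<Rightarrow> nat \<Rightarrow> nat \<Rightarrow> int" where
  "laces A i j = A i j * A j i"

definition braid_length :: "(int \<times> nat) set" where
  "braid_length = {(0, 2), (1, 3), (2, 4), (3, 6)}"

text \<open>The product \<open>x y x \<dots>\<close> with \<open>m\<close> factors.\<close>

fun alternating :: "nat \<Rightarrow> 'g word \<Rightarrow> 'g word \<Rightarrow> 'g word" where
  "alternating 0 x y = []"
| "alternating (Suc m) x y = x @ alternating m y x"

definition braid_relation :: "nat \<Rightarrow> 'g word \<Rightarrow> 'g word \<Rightarrow> 'g word \<times> 'g word" where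
  "braid_relation m x y = (alternating m x y, alternating m y x)"

definition D_word :: "triple_gen word" where
  "D_word = gen (T0 1) @ gen (T0 2) @ gen (T0 3)"

definition rels_a :: "nat \<Rightarrow> (nat \<Rightarrow> nat \<Rightarrow> int) \<Rightarrow> (triple_gen word \<times> triple_gen word) set" where
  "rels_a n A = {braid_relation m (gen x) (gen y) | m x y.
     x \<in> triple_gens n \<and> y \<in> triple_gens n \<and> node x \<noteq> node y \<and> (laces A (node x) (node y), m) \<in> braid_length}"

definition rels_b :: "nat \<Rightarrow> (nat \<Rightarrow> nat \<Rightarrow> int) \<Rightarrow> (triple_gen word \<times> triple_gen word) set" where
  "rels_b n A = {braid_relation 3 w (wpow D_word k @ gen (T \<alpha>) @ wpow D_word (- k)) | w \<alpha> k.
     w \<in> {gen (T0 1), gen (T0 2), gen (T0 3),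
          gen (T0 1) @ gen (T0 2) @ winv (gen (T0 1)),
          winv (gen (T0 3)) @ gen (T0 2) @ gen (T0 3)} \<and>
     \<alpha> \<in> {1..n} \<and> laces A 0 \<alpha> = 1}"

definition rels_c :: "nat \<Rightarrow> (nat \<Rightarrow> nat \<Rightarrow> int) \<Rightarrow> (triple_gen word \<times> triple_gen word) set" where
  "rels_c n A = {(gen (T0 i) @ winv (gen (T \<alpha>)) @ gen (T0 j) @ gen (T \<alpha>),
                  winv (gen (T \<alpha>)) @ gen (T0 j) @ gen (T \<alpha>) @ gen (T0 i)) | i j \<alpha>.
     1 \<le> i \<and> i < j \<and> j \<le> 3 \<and> \<alpha> \<in> {1..n} \<and> laces A 0 \<alpha> = 2}"

definition triple_rels :: "nat \<Rightarrow> (nat \<Rightarrow> nat \<Rightarrow> int) \<Rightarrow> (triple_gen word \<times> triple_gen word) set" where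
  "triple_rels n A = rels_a n A \<union> rels_b n A \<union> rels_c n A"

definition triple_group :: "nat \<Rightarrow> (nat \<Rightarrow> nat \<Rightarrow> int) \<Rightarrow> triple_gen word set monoid" where
  "triple_group n A = presented_group (triple_gens n) (triple_rels n A)"

definition triple_elt :: "nat \<Rightarrow> (nat \<Rightarrow> nat \<Rightarrow> int) \<Rightarrow> triple_gen \<Rightarrow> triple_gen word set" where
  "triple_elt n A x = pgen (triple_gens n) (triple_rels n A) x"

lemma alternating_in_words: "x \<in> words S \<Longrightarrow> y \<in> words S \<Longrightarrow> alternating m x y \<in> words S"
  by (induction m x y rule: alternating.induct) auto

lemma D_word_in_words: "D_word \<in> words (triple_gens n)"
  by (simp add: D_word_def triple_gens_def)

lemma triple_rels_in_words: "triple_rels n A \<subseteq> words (triple_gens n) \<times> words (triple_gens n)"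
proof -
  have T0: "T0 i \<in> triple_gens n \<longleftrightarrow> i \<in> {1, 2, 3}" for i
    by (auto simp: triple_gens_def)
  have T: "T \<alpha> \<in> triple_gens n \<longleftrightarrow> \<alpha> \<in> {1..n}" for \<alpha>
    by (auto simp: triple_gens_def)
  have "rels_a n A \<subseteq> words (triple_gens n) \<times> words (triple_gens n)"
    by (auto simp: rels_a_def braid_relation_def intro!: alternating_in_words)
  moreover have "rels_b n A \<subseteq> words (triple_gens n) \<times> words (triple_gens n)"
    by (auto simp: rels_b_def braid_relation_def T T0
        intro!: alternating_in_words wpow_in_words D_word_in_words)
  moreover have "rels_c n A \<subseteq> words (triple_gens n) \<times> words (triple_gens n)"
    by (auto simp: rels_c_def T T0)
  ultimately show ?thesis
    by (simp add: triple_rels_def)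
qed

lemma group_triple_group: "group (triple_group n A)"
  unfolding triple_group_def by (intro group_presented_group triple_rels_in_words)


section \<open>The braid group on three letters and its action\<close>

datatype b3_gen = Letter_a | Letter_b

definition b3_rels :: "(b3_gen word \<times> b3_gen word) set" where
  "b3_rels = {(gen Letter_a @ gen Letter_b @ gen Letter_a, gen Letter_b @ gen Letter_a @ gen Letter_b)}"

definition B3 :: "b3_gen word set monoid" where
  "B3 = presented_group UNIV b3_rels"

definition B3_a :: "b3_gen word set" where
  "B3_a = pgen UNIV b3_rels Letter_a"

definition B3_b :: "b3_gen word set" where
  "B3_b = pgen UNIV b3_rels Letter_b"

lemma group_B3: "group B3"
  unfolding B3_def by (rule group_presented_group) (simp add: b3_rels_def)

text \<open>The two predicates prescribe the images of the generators, which determine an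
  automorphism in \<open>carrier (AutoGroup (triple_group n A))\<close> uniquely.\<close>

definition is_underline_a ::
  "nat \<Rightarrow> (nat \<Rightarrow> nat \<Rightarrow> int) \<Rightarrow> (triple_gen word set \<Rightarrow> triple_gen word set) \<Rightarrow> bool" where
  "is_underline_a n A f \<longleftrightarrow>
     (let G = triple_group n A; t = triple_elt n A in
        f \<in> carrier (AutoGroup G) \<and>
        (\<forall>i\<in>{1..n}. f (t (T i)) = t (T i)) \<and>
        f (t (T0 3)) = t (T0 3) \<and>
        f (t (T0 1)) = t (T0 2) \<and>
        f (t (T0 2)) = inv\<^bsub>G\<^esub> t (T0 2) \<otimes>\<^bsub>G\<^esub> t (T0 1) \<otimes>\<^bsub>G\<^esub> t (T0 2))"

definition is_underline_b ::
  "nat \<Rightarrow> (nat \<Rightarrow> nat \<Rightarrow> int) \<Rightarrow> (triple_gen word set \<Rightarrow> triple_gen word set) \<Rightarrow> bool" where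
  "is_underline_b n A f \<longleftrightarrow>
     (let G = triple_group n A; t = triple_elt n A in
        f \<in> carrier (AutoGroup G) \<and>
        (\<forall>i\<in>{1..n}. f (t (T i)) = t (T i)) \<and>
        f (t (T0 1)) = t (T0 1) \<and>
        f (t (T0 2)) = t (T0 3) \<and>
        f (t (T0 3)) = inv\<^bsub>G\<^esub> t (T0 3) \<otimes>\<^bsub>G\<^esub> t (T0 2) \<otimes>\<^bsub>G\<^esub> t (T0 3))"

end

theory Submission
  imports Defs "HOL-Algebra.Coset"
begin

text \<open>
  The triple group acts linearly by reflections in the simple roots and one extra basis vector, on
  which only the three reflections of the affine node act, with three arbitrary weights. The entries
  of the matrix of the reflections are chosen so that the braid relations hold, with parameter 2 at
  the affine node; the affine reflections then behave like dilations of a line with ratio \<open>- 2\<close>, and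
  all relations b) reduce to the braid relation between one such dilation and a reflection. The
  Hurwitz action of \<open>B\<^sub>3\<close> on the three weights is the Burau representation specialised at
  \<open>t = - 2\<close>, so the kernel of \<open>\<Upsilon>\<close> is contained in the kernel of the latter, and that is trivial:
  \<open>b\<close> and \<open>a\<^sup>-\<^sup>1\<close> act by nonnegative matrices, every braid is a positive word in these two
  multiplied by powers of the Garside element, and the Garside element acts antidiagonally.
\<close>

section \<open>Presented groups\<close>

lemma word_classE:
  assumes "C \<in> carrier (presented_group S R)"
  obtains w where "w \<in> words S" "C = word_rel S R `` {w}"
  using assms by (auto simp: presented_group_def elim: quotientE)

lemma one_presented_group: "\<one>\<^bsub>presented_group S R\<^esub> = word_rel S R `` {[]}"
  by (simp add: presented_group_def)

lemma word_class_closed [simp]: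
  "w \<in> words S \<Longrightarrow> word_rel S R `` {w} \<in> carrier (presented_group S R)"
  by (simp add: presented_group_def quotientI)

lemma inv_presented_group:
  assumes "R \<subseteq> words S \<times> words S" "w \<in> words S"
  shows "inv\<^bsub>presented_group S R\<^esub> (word_rel S R `` {w}) = word_rel S R `` {winv w}"
  using assms word_rel_winv[OF assms(1), of w]
  by (intro group.inv_equality[OF group_presented_group])
    (simp_all add: mult_presented_group one_presented_group equiv_class_eq[OF equiv_word_rel])

lemma fold_winv:
  assumes "\<And>x e z. x \<in> S \<Longrightarrow> op (x, \<not> e) (op (x, e) z) = z" "w \<in> words S"
  shows "fold op (winv w) (fold op w z) = z"
  using assms(2)
proof (induction w arbitrary: z)
  case (Cons p w)
  then show ?case
    using assms(1)[of "fst p" "snd p"] by (cases p) (simp add: winv_def)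
qed (simp add: winv_def)

lemma winv_winv [simp]: "winv (winv w) = w"
  by (induction w) (auto simp: winv_def)

lemma fold_concat_replicate: "fold op (concat (replicate k w)) = fold op w ^^ k"
  by (induction k) (simp_all add: funpow_Suc_right del: funpow.simps(2))

lemma funpow_cancel:
  fixes f g :: "'a \<Rightarrow> 'a"
  assumes "\<And>z. g (f z) = z"
  shows "(g ^^ k) ((f ^^ k) z) = z"
proof (induction k arbitrary: z)
  case (Suc k)
  have "(g ^^ Suc k) ((f ^^ Suc k) z) = (g ^^ k) (g (f ((f ^^ k) z)))"
    by (simp add: funpow_swap1)
  then show ?case
    by (simp add: assms Suc)
qed simp

text \<open>Serves the conjugations by powers of \<open>D_word\<close> in relations b). For either
  sign of \<open>k\<close> it iterates the cancellation of \<open>w\<close> against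
  \<open>winv w\<close>.\<close>

lemma fold_wpow_minus:
  assumes "\<And>x e z. x \<in> S \<Longrightarrow> op (x, \<not> e) (op (x, e) z) = z" "w \<in> words S"
  shows "fold op (wpow w (- k)) (fold op (wpow w k) z) = z"
proof -
  have "fold op (winv w) (fold op w z) = z" "fold op w (fold op (winv w) z) = z" for z
    using fold_winv[of S op w z] fold_winv[of S op "winv w" z] assms by simp_all
  then show ?thesis
    by (auto simp: wpow_def fold_concat_replicate funpow_cancel)
qed

text \<open>This is a right action: \<^const>\<open>fold\<close> applies the first letter of a word first.\<close>

locale word_action =
  fixes S :: "'g set" and R :: "('g word \<times> 'g word) set" and op :: "'g \<times> bool \<Rightarrow> 'v \<Rightarrow> 'v"
  assumes rels_in_words: "R \<subseteq> words S \<times> words S"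
    and op_cancel: "x \<in> S \<Longrightarrow> op (x, \<not> e) (op (x, e) z) = z"
    and op_rels: "(l, r) \<in> R \<Longrightarrow> fold op l z = fold op r z"
begin

lemma fold_word_rel:
  assumes "(u, v) \<in> word_rel S R"
  shows "fold op u = fold op v"
  using assms by induction (auto simp: op_cancel op_rels fun_eq_iff)

text \<open>A representative is picked by choice; \<open>fold_word_rel\<close> makes the result
  independent of it.\<close>

definition class_act :: "'g word set \<Rightarrow> 'v \<Rightarrow> 'v" where
  "class_act C = fold op (SOME w. w \<in> C)"

lemma class_act_class:
  assumes "w \<in> words S"
  shows "class_act (word_rel S R `` {w}) = fold op w"
proof -
  have "w \<in> word_rel S R `` {w}"
    using assms by (simp add: word_rel.refl)
  then have "(SOME u. u \<in> word_rel S R `` {w}) \<in> word_rel S R `` {w}"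
    by (rule someI)
  then show ?thesis
    by (simp add: class_act_def fold_word_rel)
qed

lemma class_act_one [simp]: "class_act \<one>\<^bsub>presented_group S R\<^esub> z = z"
  by (simp add: one_presented_group class_act_class)

lemma class_act_mult:
  assumes "C \<in> carrier (presented_group S R)" "D \<in> carrier (presented_group S R)"
  shows "class_act (C \<otimes>\<^bsub>presented_group S R\<^esub> D) z = class_act D (class_act C z)"
  using assms by (auto elim!: word_classE simp: class_act_class mult_presented_group[OF rels_in_words])

lemma class_act_pgen: "x \<in> S \<Longrightarrow> class_act (pgen S R x) = op (x, True)"
  by (simp add: pgen_def class_act_class) (simp add: gen_def)

lemma class_act_inv_pgen:
  "x \<in> S \<Longrightarrow> class_act (inv\<^bsub>presented_group S R\<^esub> pgen S R x) = op (x, False)"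
  by (simp add: pgen_def inv_presented_group[OF rels_in_words] class_act_class)
    (simp add: gen_def winv_def)

end

section \<open>A normal form in the braid group on three letters\<close>

locale braid_pair = group +
  fixes a b
  assumes a_closed [simp]: "a \<in> carrier G" and b_closed [simp]: "b \<in> carrier G"
    and braid: "a \<otimes> b \<otimes> a = b \<otimes> a \<otimes> b"
begin

lemma cancel_inv_left [simp]:
  assumes "x \<in> carrier G" "z \<in> carrier G"
  shows "inv x \<otimes> (x \<otimes> z) = z" "x \<otimes> (inv x \<otimes> z) = z"
  using assms by (simp_all add: m_assoc[symmetric])

section \<open>The Garside element and words in \<open>b\<close> and the inverse of
  \<open>a\<close>\<close>

definition garside ("\<Delta>") where
  "\<Delta> = a \<otimes> b \<otimes> a"

inductive_set positive :: "'a set" where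
  one: "\<one> \<in> positive"
| b: "p \<in> positive \<Longrightarrow> p \<otimes> b \<in> positive"
| inv_a: "p \<in> positive \<Longrightarrow> p \<otimes> inv a \<in> positive"

lemma positive_closed [simp]: "p \<in> positive \<Longrightarrow> p \<in> carrier G"
  by (induction rule: positive.induct) auto

lemma garside_closed [simp]: "\<Delta> \<in> carrier G"
  by (simp add: garside_def)

lemma garside_a: "\<Delta> \<otimes> a = b \<otimes> \<Delta>"
proof -
  have "\<Delta> \<otimes> a = b \<otimes> a \<otimes> b \<otimes> a"
    by (simp add: garside_def braid)
  then show ?thesis
    by (simp add: garside_def m_assoc)
qed

lemma garside_b: "\<Delta> \<otimes> b = a \<otimes> \<Delta>"
proof -
  have "\<Delta> \<otimes> b = a \<otimes> (b \<otimes> a \<otimes> b)"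
    unfolding garside_def by (simp add: m_assoc)
  then show ?thesis
    by (simp add: garside_def braid)
qed

lemma garside_inv_a: "\<Delta> \<otimes> inv a = inv b \<otimes> \<Delta>"
proof -
  have "inv b \<otimes> \<Delta> = inv b \<otimes> (\<Delta> \<otimes> a) \<otimes> inv a"
    by (simp add: m_assoc)
  also have "\<dots> = inv b \<otimes> b \<otimes> \<Delta> \<otimes> inv a"
    by (simp only: garside_a) (simp add: m_assoc)
  finally show ?thesis
    by simp
qed

lemma garside_inv_b: "\<Delta> \<otimes> inv b = inv a \<otimes> \<Delta>"
proof -
  have "inv a \<otimes> \<Delta> = inv a \<otimes> (\<Delta> \<otimes> b) \<otimes> inv b"
    by (simp add: m_assoc)
  also have "\<dots> = inv a \<otimes> a \<otimes> \<Delta> \<otimes> inv b"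
    by (simp only: garside_b) (simp add: m_assoc)
  finally show ?thesis
    by simp
qed

text \<open>Conjugation by \<Delta> exchanges \<open>x\<close> and \<open>y\<close>, so its square
  fixes both. Stated for an abstract pair to cover \<open>b\<close>, \<open>a\<close> as well as
  their inverses.\<close>

lemma garside_sq_comm:
  assumes "x \<in> carrier G" "y \<in> carrier G" "\<Delta> \<otimes> x = y \<otimes> \<Delta>" "\<Delta> \<otimes> y = x \<otimes> \<Delta>"
  shows "x \<otimes> (\<Delta> \<otimes> \<Delta>) = \<Delta> \<otimes> \<Delta> \<otimes> x"
proof -
  have "x \<otimes> (\<Delta> \<otimes> \<Delta>) = \<Delta> \<otimes> y \<otimes> \<Delta>"
    using assms(1,2) by (simp add: assms(4) m_assoc)
  also have "\<dots> = \<Delta> \<otimes> (\<Delta> \<otimes> x)"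
    using assms(1,2) by (simp add: assms(3) m_assoc)
  finally show ?thesis
    using assms by (simp add: m_assoc)
qed

lemma positive_garside_sq:
  "p \<in> positive \<Longrightarrow> p \<otimes> (\<Delta> \<otimes> \<Delta>) = \<Delta> \<otimes> \<Delta> \<otimes> p"
proof (induction rule: positive.induct)
  case (b p)
  have "p \<otimes> b \<otimes> (\<Delta> \<otimes> \<Delta>) = p \<otimes> (\<Delta> \<otimes> \<Delta>) \<otimes> b"
    using b.hyps garside_sq_comm[OF b_closed a_closed garside_b garside_a] by (simp add: m_assoc)
  then show ?case
    using b.hyps by (simp only: b.IH) (simp add: m_assoc)
next
  case (inv_a p)
  have "p \<otimes> inv a \<otimes> (\<Delta> \<otimes> \<Delta>) = p \<otimes> (\<Delta> \<otimes> \<Delta>) \<otimes> inv a"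
    using inv_a.hyps garside_sq_comm[OF _ _ garside_inv_a garside_inv_b] by (simp add: m_assoc)
  then show ?case
    using inv_a.hyps by (simp only: inv_a.IH) (simp add: m_assoc)
qed auto

text \<open>The square of \<Delta> can be moved through \<open>p\<close> to the left, but a single
  \<Delta> would turn \<open>p\<close> into a word in \<open>a\<close> and the inverse of
  \<open>b\<close>, which is no longer in \<open>positive\<close>. Hence at most one \<Delta> is
  kept on the right.\<close>

definition normal_forms :: "'a set" where
  "normal_forms = {\<Delta> [^] k \<otimes> p \<otimes> d | (k :: int) p d. p \<in> positive \<and> d \<in> {\<one>, \<Delta>}}"

lemma normal_form0: "p \<in> positive \<Longrightarrow> \<Delta> [^] (k :: int) \<otimes> p \<in> normal_forms"
  unfolding normal_forms_def by (rule CollectI, rule exI[of _ k], rule exI[of _ p], rule exI[of _ \<one>]) auto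

lemma normal_form1: "p \<in> positive \<Longrightarrow> \<Delta> [^] (k :: int) \<otimes> p \<otimes> \<Delta> \<in> normal_forms"
  unfolding normal_forms_def by auto

lemma normal_formsE [elim?]:
  assumes "g \<in> normal_forms"
  obtains (zero) k :: int and p where "p \<in> positive" "g = \<Delta> [^] k \<otimes> p"
    | (one) k :: int and p where "p \<in> positive" "g = \<Delta> [^] k \<otimes> p \<otimes> \<Delta>"
  using assms unfolding normal_forms_def by auto

lemma garside_pow_Suc: "\<Delta> [^] (k :: int) \<otimes> \<Delta> = \<Delta> [^] (k + 1)"
  using int_pow_mult[of \<Delta> k 1] by simp

lemma garside_pow_pred: "\<Delta> [^] (k :: int) \<otimes> inv \<Delta> = \<Delta> [^] (k - 1)"
  using int_pow_diff[of \<Delta> k 1] by simp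

lemma positive_garside_sq':
  assumes "p \<in> positive" "z \<in> carrier G"
  shows "p \<otimes> (\<Delta> \<otimes> (\<Delta> \<otimes> z)) = \<Delta> \<otimes> (\<Delta> \<otimes> (p \<otimes> z))"
proof -
  have "p \<otimes> (\<Delta> \<otimes> (\<Delta> \<otimes> z)) = p \<otimes> (\<Delta> \<otimes> \<Delta>) \<otimes> z"
    using assms by (simp add: m_assoc)
  then show ?thesis
    using assms by (simp add: positive_garside_sq) (simp add: m_assoc)
qed

lemma normal_forms_garside:
  assumes "g \<in> normal_forms"
  shows "g \<otimes> \<Delta> \<in> normal_forms"
  using assms
proof (cases rule: normal_formsE)
  case (zero k p)
  then show ?thesis by (simp add: normal_form1)
next
  case (one k p)
  have "g \<otimes> \<Delta> = \<Delta> [^] k \<otimes> (p \<otimes> (\<Delta> \<otimes> \<Delta>))"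
    using one by (simp add: m_assoc)
  also have "\<dots> = \<Delta> [^] k \<otimes> \<Delta> \<otimes> \<Delta> \<otimes> p"
    using one(1) by (simp add: positive_garside_sq) (simp add: m_assoc)
  finally show ?thesis
    using one by (simp add: garside_pow_Suc normal_form0)
qed

lemma normal_forms_inv_garside:
  assumes "g \<in> normal_forms"
  shows "g \<otimes> inv \<Delta> \<in> normal_forms"
  using assms
proof (cases rule: normal_formsE)
  case (zero k p)
  \<comment> \<open>The inverse of \<Delta> is traded for \<Delta> times the inverse of its central
    square, which explains the exponent \<open>k - 2\<close>.\<close>
  have "\<Delta> [^] (k - 2) \<otimes> p \<otimes> \<Delta> \<otimes> \<Delta> = \<Delta> [^] (k - 2) \<otimes> (p \<otimes> (\<Delta> \<otimes> \<Delta>))"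
    using zero by (simp add: m_assoc)
  also have "\<dots> = \<Delta> [^] (k - 2) \<otimes> \<Delta> \<otimes> \<Delta> \<otimes> p"
    using zero(1) by (simp add: positive_garside_sq) (simp add: m_assoc)
  also have "\<dots> = g"
    using zero by (simp add: garside_pow_Suc)
  finally have "g \<otimes> inv \<Delta> = \<Delta> [^] (k - 2) \<otimes> p \<otimes> \<Delta>"
    using zero(1) inv_solve_right'[of "\<Delta> [^] (k - 2) \<otimes> p \<otimes> \<Delta>" g \<Delta>] zero(2)
    by simp
  then show ?thesis
    using zero by (simp add: normal_form1)
next
  case (one k p)
  then show ?thesis by (simp add: m_assoc normal_form0)
qed

text \<open>Only a trailing \<Delta> is a problem. Then \<Delta> stands between the last letter of
  \<open>p\<close> and the new letter, and each of the four products letter, \<Delta>, letter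
  collapses: to \<Delta> if the letters differ, to \<open>b\<close> for two inverses of
  \<open>a\<close>, and to the square of \<Delta> times the inverse of \<open>a\<close> for two
  letters \<open>b\<close>.\<close>

lemma normal_forms_positive_letter:
  assumes "g \<in> normal_forms"
  shows "g \<otimes> b \<in> normal_forms" and "g \<otimes> inv a \<in> normal_forms"
proof -
  have ya: "inv a \<otimes> (\<Delta> \<otimes> b) = \<Delta>"
    by (simp add: garside_b)
  have yy: "inv a \<otimes> (\<Delta> \<otimes> inv a) = b"
    by (simp add: garside_def m_assoc)
  have "b \<otimes> (\<Delta> \<otimes> inv a) = \<Delta> \<otimes> a \<otimes> inv a"
    by (simp only: garside_a) (simp add: m_assoc)
  then have xy: "b \<otimes> (\<Delta> \<otimes> inv a) = \<Delta>"
    by (simp add: m_assoc)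
  have "b \<otimes> (\<Delta> \<otimes> b) = \<Delta> \<otimes> a \<otimes> b"
    by (simp only: garside_a) (simp add: m_assoc)
  also have "\<dots> = \<Delta> \<otimes> (\<Delta> \<otimes> inv a)"
    by (simp add: garside_def m_assoc)
  finally have xx: "b \<otimes> (\<Delta> \<otimes> b) = \<Delta> \<otimes> (\<Delta> \<otimes> inv a)" .
  have "g \<otimes> b \<in> normal_forms \<and> g \<otimes> inv a \<in> normal_forms"
    using assms
  proof (cases rule: normal_formsE)
    case (zero k p)
    then show ?thesis
      using normal_form0[OF positive.b, of p k] normal_form0[OF positive.inv_a, of p k]
      by (simp add: m_assoc)
  next
    case (one k p)
    from one(1) show ?thesis
    proof cases
      case one': one
      then have "g = \<Delta> [^] (k + 1)"
        using one by (simp add: garside_pow_Suc)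
      then show ?thesis
        using normal_form0[OF positive.b[OF positive.one], of "k + 1"]
          normal_form0[OF positive.inv_a[OF positive.one], of "k + 1"] by simp
    next
      case (b p')
      have "g \<otimes> b = \<Delta> [^] k \<otimes> \<Delta> \<otimes> \<Delta> \<otimes> (p' \<otimes> inv a)"
        using one(2) b by (simp add: m_assoc xx positive_garside_sq')
      then have 1: "g \<otimes> b = \<Delta> [^] (k + 1 + 1) \<otimes> (p' \<otimes> inv a)"
        by (simp only: garside_pow_Suc)
      have "g \<otimes> inv a = \<Delta> [^] k \<otimes> p' \<otimes> \<Delta>"
        using one(2) b by (simp add: m_assoc xy)
      with 1 b show ?thesis
        by (simp add: normal_form0 normal_form1 positive.inv_a)
    next
      case (inv_a p')
      have "g \<otimes> b = \<Delta> [^] k \<otimes> p' \<otimes> \<Delta>"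
        using one(2) inv_a by (simp add: m_assoc ya)
      moreover have "g \<otimes> inv a = \<Delta> [^] k \<otimes> (p' \<otimes> b)"
        using one(2) inv_a by (simp add: m_assoc yy)
      ultimately show ?thesis
        using inv_a by (simp add: normal_form0 normal_form1 positive.b)
    qed
  qed
  then show "g \<otimes> b \<in> normal_forms" and "g \<otimes> inv a \<in> normal_forms"
    by auto
qed

lemma normal_forms_closed: "g \<in> normal_forms \<Longrightarrow> g \<in> carrier G"
  by (auto simp: normal_forms_def)

text \<open>The two missing letters are conjugates by \<Delta> of the good ones: \<open>a\<close> of
  \<open>b\<close>, and the inverse of \<open>b\<close> of the inverse of \<open>a\<close>.\<close>

lemma normal_forms_letter:
  assumes g: "g \<in> normal_forms" and x: "x \<in> {a, inv a, b, inv b}"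
  shows "g \<otimes> x \<in> normal_forms"
proof -
  have "g \<otimes> a = g \<otimes> \<Delta> \<otimes> b \<otimes> inv \<Delta>"
    using normal_forms_closed[OF g] garside_b
    by (metis a_closed b_closed garside_closed inv_solve_right m_assoc m_closed)
  moreover have "g \<otimes> inv b = g \<otimes> \<Delta> \<otimes> inv a \<otimes> inv \<Delta>"
    using normal_forms_closed[OF g] garside_inv_a
    by (metis a_closed b_closed inv_closed garside_closed inv_solve_right m_assoc m_closed)
  ultimately have "g \<otimes> a \<in> normal_forms" "g \<otimes> inv b \<in> normal_forms"
    by (simp_all add: g normal_forms_garside normal_forms_positive_letter normal_forms_inv_garside)
  then show ?thesis
    using x normal_forms_positive_letter[OF g] by auto
qed

end

section \<open>Faithfulness of the Burau action\<close>

lemma b3_rels_in_words: "b3_rels \<subseteq> words UNIV \<times> words UNIV"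
  by (simp add: b3_rels_def)

lemma pgen_closed: "x \<in> S \<Longrightarrow> pgen S R x \<in> carrier (presented_group S R)"
  by (simp add: pgen_def)

interpretation B3: braid_pair B3 B3_a B3_b
proof -
  interpret group B3 by (rule group_B3)
  have "(gen Letter_a @ gen Letter_b @ gen Letter_a, gen Letter_b @ gen Letter_a @ gen Letter_b)
      \<in> word_rel UNIV b3_rels"
    using word_rel.rel[of _ _ b3_rels "[]" UNIV "[]"] by (simp add: b3_rels_def)
  then show "braid_pair B3 B3_a B3_b"
    by unfold_locales
      (simp_all add: B3_def B3_a_def B3_b_def pgen_def mult_presented_group[OF b3_rels_in_words]
        equiv_class_eq[OF equiv_word_rel[OF b3_rels_in_words]])
qed

lemma B3_letter:
  "word_rel UNIV b3_rels `` {[(x, e)]}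
    = (let g = (case x of Letter_a \<Rightarrow> B3_a | Letter_b \<Rightarrow> B3_b) in if e then g else inv\<^bsub>B3\<^esub> g)"
  by (cases x; cases e)
    (simp_all add: B3_def B3_a_def B3_b_def pgen_def inv_presented_group[OF b3_rels_in_words] gen_def winv_def)

lemma B3_snoc:
  assumes "w \<in> words UNIV"
  shows "word_rel UNIV b3_rels `` {w @ [(x, e)]}
    = word_rel UNIV b3_rels `` {w} \<otimes>\<^bsub>B3\<^esub> word_rel UNIV b3_rels `` {[(x, e)]}"
  using assms by (simp add: B3_def mult_presented_group[OF b3_rels_in_words])

text \<open>Normal forms contain the unit and are stable under right multiplication by letters, so
  they exhaust the classes of words.\<close>

lemma B3_normal_form:
  assumes "g \<in> carrier B3"
  shows "g \<in> B3.normal_forms"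
proof -
  have "word_rel UNIV b3_rels `` {w} \<in> B3.normal_forms" if "w \<in> words UNIV" for w
    using that
  proof (induction w rule: rev_induct)
    case Nil
    have "\<one>\<^bsub>B3\<^esub> = word_rel UNIV b3_rels `` {[]}"
      by (simp add: B3_def one_presented_group)
    moreover have "\<one>\<^bsub>B3\<^esub> \<in> B3.normal_forms"
      using B3.normal_form0[OF B3.positive.one, of 0] by simp
    ultimately show ?case
      by simp
  next
    case (snoc p w)
    obtain x e where p: "p = (x, e)" by force
    show ?case
      using snoc B3.normal_forms_letter[of "word_rel UNIV b3_rels `` {w}"]
      by (simp add: p B3_snoc B3_letter Let_def split: b3_gen.split)
  qed
  then show ?thesis
    using assms unfolding B3_def by (elim word_classE) auto
qed

text \<open>The reduced Burau representation at \<open>t = -2\<close>: here \<open>b\<close> and the inverse of \<open>a\<close> act by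
  matrices with nonnegative entries.\<close>

fun burau :: "b3_gen \<times> bool \<Rightarrow> real \<times> real \<Rightarrow> real \<times> real" where
  "burau (Letter_a, True) (x, y) = (2 * x, y - 2 * x)"
| "burau (Letter_a, False) (x, y) = (x / 2, x + y)"
| "burau (Letter_b, True) (x, y) = (x + y, 2 * y)"
| "burau (Letter_b, False) (x, y) = (x - y / 2, y / 2)"

interpretation burau: word_action UNIV b3_rels burau
proof
  show "burau (x, \<not> e) (burau (x, e) z) = z" for x e z
    by (cases x; cases e; cases z) auto
  show "fold burau l z = fold burau r z" if "(l, r) \<in> b3_rels" for l r z
    using that by (cases z) (auto simp: b3_rels_def gen_def)
qed (rule b3_rels_in_words)

abbreviation "\<beta> \<equiv> burau.class_act"

section \<open>Positivity and determinants of Burau matrices\<close>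

lemmas burau_one = burau.class_act_one[folded B3_def]
lemmas burau_mult = burau.class_act_mult[folded B3_def]

lemma burau_letters:
  "\<beta> B3_a = burau (Letter_a, True)" "\<beta> B3_b = burau (Letter_b, True)"
  "\<beta> (inv\<^bsub>B3\<^esub> B3_a) = burau (Letter_a, False)"
  unfolding B3_a_def B3_b_def B3_def by (simp_all add: burau.class_act_pgen burau.class_act_inv_pgen)

text \<open>The invariant of the induction: positive diagonal, nonnegative off-diagonal entries, and
  one positive off-diagonal entry as soon as a letter has been read. The last clause separates
  nontrivial \<open>p\<close> from powers of the Garside element.\<close>

lemma burau_positive:
  assumes "p \<in> B3.positive"
  shows "\<exists>c11 c12 c21 c22. (\<forall>x y. \<beta> p (x, y) = (c11 * x + c12 * y, c21 * x + c22 * y))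
    \<and> c11 > 0 \<and> c22 > 0 \<and> c12 \<ge> 0 \<and> c21 \<ge> 0 \<and> (p = \<one>\<^bsub>B3\<^esub> \<or> c12 > 0 \<or> c21 > 0)"
  using assms
proof induction
  case one
  have "\<beta> \<one>\<^bsub>B3\<^esub> (x, y) = (1 * x + 0 * y, 0 * x + 1 * y)" for x y
    by (simp add: burau_one)
  then show ?case
    by (intro exI[of _ 1] exI[of _ 0]) auto
next
  case (b p)
  then obtain c11 c12 c21 c22
    where c: "\<And>x y. \<beta> p (x, y) = (c11 * x + c12 * y, c21 * x + c22 * y)"
      "c11 > 0" "c22 > 0" "c12 \<ge> 0" "c21 \<ge> 0" by blast
  have "\<beta> (p \<otimes>\<^bsub>B3\<^esub> B3_b) (x, y)
      = ((c11 + c21) * x + (c12 + c22) * y, 2 * c21 * x + 2 * c22 * y)" for x y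
    using b.hyps by (simp add: burau_mult burau_letters c algebra_simps)
  moreover have "c11 + c21 > 0" "2 * c22 > 0" "c12 + c22 > 0" "2 * c21 \<ge> 0" "c12 + c22 \<ge> 0"
    using c by linarith+
  ultimately show ?case by blast
next
  case (inv_a p)
  then obtain c11 c12 c21 c22
    where c: "\<And>x y. \<beta> p (x, y) = (c11 * x + c12 * y, c21 * x + c22 * y)"
      "c11 > 0" "c22 > 0" "c12 \<ge> 0" "c21 \<ge> 0" by blast
  have "\<beta> (p \<otimes>\<^bsub>B3\<^esub> inv\<^bsub>B3\<^esub> B3_a) (x, y)
      = ((c11 / 2) * x + (c12 / 2) * y, (c11 + c21) * x + (c12 + c22) * y)" for x y
    using inv_a.hyps by (simp add: burau_mult burau_letters c algebra_simps add_divide_distrib)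
  moreover have "c11 / 2 > 0" "c12 + c22 > 0" "c11 + c21 > 0" "c12 / 2 \<ge> 0" "c11 + c21 \<ge> 0"
    using c by linarith+
  ultimately show ?case by blast
qed

lemma burau_garside: "\<beta> B3.garside (x, y) = (2 * y, - 4 * x)"
  by (simp add: B3.garside_def burau_mult burau_letters)

lemma burau_inv_garside: "\<beta> (inv\<^bsub>B3\<^esub> B3.garside) (x, y) = (- y / 4, x / 2)"
proof -
  have "\<beta> (B3.garside \<otimes>\<^bsub>B3\<^esub> inv\<^bsub>B3\<^esub> B3.garside) (- y / 4, x / 2) = (- y / 4, x / 2)"
    by (simp add: burau_one)
  then show ?thesis
    by (subst (asm) burau_mult) (simp_all add: burau_garside)
qed

text \<open>The Garside element acts by an antidiagonal matrix of determinant 8, so its powers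
  alternate between diagonal and antidiagonal matrices. The absolute value of \<open>c * d\<close>
  is that of the determinant in both shapes and remembers the exponent.\<close>

lemma burau_garside_pow:
  "\<exists>c d. \<bar>c * d\<bar> = 8 powi k \<and>
    ((\<forall>x y. \<beta> (B3.garside [^]\<^bsub>B3\<^esub> k) (x, y) = (c * x, d * y)) \<or>
     (\<forall>x y. \<beta> (B3.garside [^]\<^bsub>B3\<^esub> k) (x, y) = (c * y, d * x)))"
proof (induction k rule: int_induct[of _ 0])
  case base
  show ?case
    by (intro exI[of _ 1]) (simp add: burau_one)
next
  case (step1 k)
  then obtain c d where cd: "\<bar>c * d\<bar> = 8 powi k"
    "(\<forall>x y. \<beta> (B3.garside [^]\<^bsub>B3\<^esub> k) (x, y) = (c * x, d * y)) \<or>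
     (\<forall>x y. \<beta> (B3.garside [^]\<^bsub>B3\<^esub> k) (x, y) = (c * y, d * x))" by blast
  have "\<bar>(2 * d) * (- 4 * c)\<bar> = 8 * \<bar>c * d\<bar>"
    by (simp add: abs_mult)
  also have "\<dots> = 8 powi (k + 1)"
    by (simp add: cd(1) power_int_add_1')
  finally have "\<bar>(2 * d) * (- 4 * c)\<bar> = 8 powi (k + 1)" .
  moreover have "\<beta> (B3.garside [^]\<^bsub>B3\<^esub> (k + 1)) z = \<beta> B3.garside (\<beta> (B3.garside [^]\<^bsub>B3\<^esub> k) z)" for z
    by (simp add: B3.garside_pow_Suc[symmetric] burau_mult)
  ultimately show ?case
    using cd(2) by (intro exI[of _ "2 * d"] exI[of _ "- 4 * c"]) (auto simp: burau_garside)
next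
  case (step2 k)
  then obtain c d where cd: "\<bar>c * d\<bar> = 8 powi k"
    "(\<forall>x y. \<beta> (B3.garside [^]\<^bsub>B3\<^esub> k) (x, y) = (c * x, d * y)) \<or>
     (\<forall>x y. \<beta> (B3.garside [^]\<^bsub>B3\<^esub> k) (x, y) = (c * y, d * x))" by blast
  have "\<bar>(- d / 4) * (c / 2)\<bar> = \<bar>c * d\<bar> / 8"
    by (simp add: abs_mult)
  also have "\<dots> = 8 powi (k - 1)"
    by (simp add: cd(1) power_int_diff)
  finally have "\<bar>(- d / 4) * (c / 2)\<bar> = 8 powi (k - 1)" .
  moreover have "\<beta> (B3.garside [^]\<^bsub>B3\<^esub> (k - 1)) z
      = \<beta> (inv\<^bsub>B3\<^esub> B3.garside) (\<beta> (B3.garside [^]\<^bsub>B3\<^esub> k) z)" for z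
    by (simp add: B3.garside_pow_pred[symmetric] burau_mult)
  ultimately show ?case
    using cd(2) by (intro exI[of _ "- d / 4"] exI[of _ "c / 2"]) (auto simp: burau_inv_garside)
qed

text \<open>A positive diagonal rules out the antidiagonal shape, and the diagonal shape leaves no
  positive off-diagonal entry; only the unit remains in \<open>burau_positive\<close>.\<close>

lemma burau_positive_eq_garside_pow:
  assumes p: "p \<in> B3.positive" and eq: "\<And>z. \<beta> p z = \<beta> (B3.garside [^]\<^bsub>B3\<^esub> (k :: int)) z"
  shows "p = \<one>\<^bsub>B3\<^esub>"
proof -
  obtain c11 c12 c21 c22
    where c: "\<And>x y. \<beta> p (x, y) = (c11 * x + c12 * y, c21 * x + c22 * y)"
      "c11 > 0" "c22 > 0" "p = \<one>\<^bsub>B3\<^esub> \<or> c12 > 0 \<or> c21 > 0"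
    using burau_positive[OF p] by blast
  obtain c d where
    "(\<forall>x y. \<beta> p (x, y) = (c * x, d * y)) \<or> (\<forall>x y. \<beta> p (x, y) = (c * y, d * x))"
    using burau_garside_pow[of k] eq by metis
  then have "(c12 = 0 \<and> c21 = 0) \<or> (c11 = 0 \<and> c22 = 0)"
  proof
    assume "\<forall>x y. \<beta> p (x, y) = (c * x, d * y)"
    from this[rule_format, of 1 0] this[rule_format, of 0 1] show ?thesis by (simp add: c)
  next
    assume "\<forall>x y. \<beta> p (x, y) = (c * y, d * x)"
    from this[rule_format, of 1 0] this[rule_format, of 0 1] show ?thesis by (simp add: c)
  qed
  with c show ?thesis by auto
qed

lemma burau_garside_pow_id:
  assumes "\<And>z. \<beta> (B3.garside [^]\<^bsub>B3\<^esub> (k :: int)) z = z"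
  shows "k = 0"
proof -
  obtain c d :: real where cd: "\<bar>c * d\<bar> = 8 powi k"
    "(\<forall>x y. (x, y) = (c * x, d * y)) \<or> (\<forall>x y. (x, y) = (c * y, d * x))"
    using burau_garside_pow[of k] unfolding assms by blast
  from cd(2) have "c = 1 \<and> d = 1"
  proof
    assume "\<forall>x y. (x, y) = (c * x, d * y)"
    from this[rule_format, of 1 1] show ?thesis by simp
  next
    assume "\<forall>x y. (x, y) = (c * y, d * x)"
    from this[rule_format, of 1 0] show ?thesis by simp
  qed
  with cd(1) have "(8 :: real) powi k = 1"
    by simp
  then show ?thesis
    using power_int_strict_increasing[of 0 k "8 :: real"] power_int_strict_increasing[of k 0 "8 :: real"]
    by (cases k "0 :: int" rule: linorder_cases) auto
qed

text \<open>If \<open>g\<close> acts trivially, the factor \<open>p\<close> of its normal form acts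
  like a power of the Garside element and is therefore trivial. Then \<open>g\<close> itself is such
  a power, and its determinant forces the exponent 0.\<close>

lemma burau_faithful:
  assumes "g \<in> carrier B3" "\<And>z. \<beta> g z = z"
  shows "g = \<one>\<^bsub>B3\<^esub>"
proof -
  have shift: "\<beta> (B3.garside [^]\<^bsub>B3\<^esub> k \<otimes>\<^bsub>B3\<^esub> g) z = \<beta> (B3.garside [^]\<^bsub>B3\<^esub> k) z" for k :: int and z
    using assms by (simp add: burau_mult)
  have pow: "g = B3.garside [^]\<^bsub>B3\<^esub> k \<Longrightarrow> g = \<one>\<^bsub>B3\<^esub>" for k :: int
    using burau_garside_pow_id[of k] assms by simp
  from B3_normal_form[OF assms(1)] show ?thesis
  proof (cases rule: B3.normal_formsE)
    case (zero k p)
    have "p = B3.garside [^]\<^bsub>B3\<^esub> (- k) \<otimes>\<^bsub>B3\<^esub> g"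
      using zero(1) unfolding zero(2) by (simp add: B3.int_pow_neg)
    then have "p = \<one>\<^bsub>B3\<^esub>"
      using burau_positive_eq_garside_pow[OF zero(1), of "- k"] shift[of "- k"] by simp
    then have "g = B3.garside [^]\<^bsub>B3\<^esub> k"
      using zero(2) by simp
    then show ?thesis by (rule pow)
  next
    case (one k p)
    have p: "p = B3.garside [^]\<^bsub>B3\<^esub> (- k) \<otimes>\<^bsub>B3\<^esub> g \<otimes>\<^bsub>B3\<^esub> inv\<^bsub>B3\<^esub> B3.garside"
      using one(1) unfolding one(2) by (simp add: B3.int_pow_neg B3.m_assoc)
    have "\<beta> p z = \<beta> (B3.garside [^]\<^bsub>B3\<^esub> (- k - 1)) z" for z
      unfolding p B3.garside_pow_pred[symmetric] using shift[of "- k"] assms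
      by (simp add: burau_mult)
    then have "p = \<one>\<^bsub>B3\<^esub>"
      by (rule burau_positive_eq_garside_pow[OF one(1)])
    then have "g = B3.garside [^]\<^bsub>B3\<^esub> (k + 1)"
      using one(2) by (simp add: B3.garside_pow_Suc)
    then show ?thesis by (rule pow)
  qed
qed

section \<open>Reflection representations of the triple group\<close>

text \<open>Data of a Hecke-type reflection representation: the reflection at node \<open>i\<close>
  has eigenvalue \<open>- q i\<close> on its root, and the products \<open>M i j * M j i\<close> are
  the values at which two such reflections satisfy the braid relation of length 2, 3, 4 or 6. The
  value \<open>q 0 = 2\<close> leads to Burau at \<open>t = -2\<close>; \<open>q_double\<close>
  makes the reflection at \<open>\<alpha>\<close> an involution.\<close>

locale reflection_data =
  fixes n :: nat and A :: "nat \<Rightarrow> nat \<Rightarrow> int" and M :: "nat \<Rightarrow> nat \<Rightarrow> real" and q :: "nat \<Rightarrow> real"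
  assumes q_affine: "q 0 = 2"
    and q_nonzero: "q i \<noteq> 0"
    and diag: "i \<le> n \<Longrightarrow> M i i = 1 + q i"
    and laces0: "i \<le> n \<Longrightarrow> j \<le> n \<Longrightarrow> i \<noteq> j \<Longrightarrow> laces A i j = 0 \<Longrightarrow> M i j = 0"
    and laces1: "i \<le> n \<Longrightarrow> j \<le> n \<Longrightarrow> i \<noteq> j \<Longrightarrow> laces A i j = 1 \<Longrightarrow> q i = q j \<and> M i j * M j i = q i"
    and laces2: "i \<le> n \<Longrightarrow> j \<le> n \<Longrightarrow> i \<noteq> j \<Longrightarrow> laces A i j = 2 \<Longrightarrow> M i j * M j i = q i + q j"
    and laces3: "i \<le> n \<Longrightarrow> j \<le> n \<Longrightarrow> i \<noteq> j \<Longrightarrow> laces A i j = 3 \<Longrightarrow> q i = q j \<and> M i j * M j i = 3 * q i"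
    and q_double: "\<alpha> \<in> {1..n} \<Longrightarrow> laces A 0 \<alpha> = 2 \<Longrightarrow> q \<alpha> = 1"
begin

text \<open>A vector \<open>v\<close> has coordinates \<open>v 0, \<dots>, v n\<close> with respect to simple roots, and one further
  coordinate \<open>v (Suc n)\<close>; the weight \<open>\<mu>\<close> is the value of the linear form on the extra basis vector.\<close>

definition form :: "nat \<Rightarrow> real \<Rightarrow> (nat \<Rightarrow> real) \<Rightarrow> real" where
  "form i \<mu> v = (\<Sum>j\<le>n. M i j * v j) + \<mu> * v (Suc n)"

definition refl :: "nat \<Rightarrow> real \<Rightarrow> (nat \<Rightarrow> real) \<Rightarrow> nat \<Rightarrow> real" where
  "refl i \<mu> v = v(i := v i - form i \<mu> v)"

text \<open>Division by \<open>q i\<close> comes from the quadratic relation: a reflection has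
  eigenvalues 1 and \<open>- q i\<close>.\<close>

definition refl_inv :: "nat \<Rightarrow> real \<Rightarrow> (nat \<Rightarrow> real) \<Rightarrow> nat \<Rightarrow> real" where
  "refl_inv i \<mu> v = v(i := v i - form i \<mu> v / q i)"

lemma form_upd:
  assumes "k \<le> n"
  shows "form i \<mu> (v(k := y)) = form i \<mu> v + M i k * (y - v k)"
proof -
  have "(\<Sum>j\<le>n. M i j * (v(k := y)) j) = (\<Sum>j\<le>n. M i j * v j + (if j = k then M i k * (y - v k) else 0))"
    by (intro sum.cong) (auto simp: algebra_simps)
  also have "\<dots> = (\<Sum>j\<le>n. M i j * v j) + M i k * (y - v k)"
    using assms by (simp add: sum.distrib)
  finally show ?thesis
    using assms by (simp add: form_def)
qed

lemma refl_inv_refl: "i \<le> n \<Longrightarrow> refl_inv i \<mu> (refl i \<mu> v) = v"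
  using q_nonzero[of i] by (simp add: refl_def refl_inv_def form_upd diag fun_eq_iff field_simps)

lemma refl_refl_inv: "i \<le> n \<Longrightarrow> refl i \<mu> (refl_inv i \<mu> v) = v"
  using q_nonzero[of i] by (simp add: refl_def refl_inv_def form_upd diag fun_eq_iff field_simps)

text \<open>Products of reflections in two roots move \<open>v\<close> by a combination of these roots, so it suffices to
  track the two coefficients.\<close>

lemma refl_shift1:
  assumes "i \<le> n" "k \<le> n" "i \<noteq> k"
  shows "refl i \<mu> (v(i := v i - x, k := v k - y))
    = v(i := v i - (form i \<mu> v - q i * x - M i k * y), k := v k - y)"
  using assms by (simp add: refl_def form_upd diag fun_eq_iff algebra_simps)

lemma refl_shift2:
  assumes "i \<le> n" "k \<le> n" "i \<noteq> k"
  shows "refl k \<mu> (v(i := v i - x, k := v k - y))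
    = v(i := v i - x, k := v k - (form k \<mu> v - q k * y - M k i * x))"
  using assms by (simp add: refl_def form_upd diag fun_eq_iff algebra_simps)

lemma shift_eqI: "x = x' \<Longrightarrow> y = y' \<Longrightarrow> v(i := v i - x, k := v k - y) = v(i := v i - x', k := v k - y')"
  by simp

section \<open>Braid relations between two reflections\<close>

lemma refl_commute:
  assumes "i \<le> n" "k \<le> n" "i \<noteq> k" "M i k = 0" "M k i = 0"
  shows "refl i \<mu> (refl k \<nu> v) = refl k \<nu> (refl i \<mu> v)"
proof -
  \<comment> \<open>The shift by zero gives \<open>v\<close> the shape on which the shift rules
    operate.\<close>
  have "refl i \<mu> (refl k \<nu> (v(i := v i - 0, k := v k - 0)))
      = refl k \<nu> (refl i \<mu> (v(i := v i - 0, k := v k - 0)))"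
    unfolding refl_shift1[OF assms(1-3)] refl_shift2[OF assms(1-3)]
    by (rule shift_eqI) (simp_all add: assms)
  then show ?thesis by simp
qed

lemma refl_braid3:
  assumes "i \<le> n" "k \<le> n" "i \<noteq> k" "q i = q k" "M i k * M k i = q i"
  shows "refl i \<mu> (refl k \<nu> (refl i \<mu> v)) = refl k \<nu> (refl i \<mu> (refl k \<nu> v))"
proof -
  have "refl i \<mu> (refl k \<nu> (refl i \<mu> (v(i := v i - 0, k := v k - 0))))
      = refl k \<nu> (refl i \<mu> (refl k \<nu> (v(i := v i - 0, k := v k - 0))))"
    unfolding refl_shift1[OF assms(1-3)] refl_shift2[OF assms(1-3)]
    unfolding assms(4)[symmetric] assms(5)[symmetric] by (rule shift_eqI) (simp_all add: algebra_simps)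
  then show ?thesis by simp
qed

lemma refl_braid4:
  assumes "i \<le> n" "k \<le> n" "i \<noteq> k" "M i k * M k i = q i + q k"
  shows "refl i \<mu> (refl k \<nu> (refl i \<mu> (refl k \<nu> v))) = refl k \<nu> (refl i \<mu> (refl k \<nu> (refl i \<mu> v)))"
proof -
  have "refl i \<mu> (refl k \<nu> (refl i \<mu> (refl k \<nu> (v(i := v i - 0, k := v k - 0)))))
      = refl k \<nu> (refl i \<mu> (refl k \<nu> (refl i \<mu> (v(i := v i - 0, k := v k - 0)))))"
    unfolding refl_shift1[OF assms(1-3)] refl_shift2[OF assms(1-3)]
    by (rule shift_eqI) (use assms(4) in algebra)+
  then show ?thesis by simp
qed

text \<open>The closed form is invariant under exchanging \<open>i\<close> and \<open>k\<close>,
  which is exactly the braid relation of length six.\<close>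

lemma refl_six:
  assumes "i \<le> n" "k \<le> n" "i \<noteq> k" "q i = q k" "M i k * M k i = 3 * q i"
  shows "refl i \<mu> (refl k \<nu> (refl i \<mu> (refl k \<nu> (refl i \<mu> (refl k \<nu> v)))))
    = v(i := v i - ((1 + q i)\<^sup>2 * form i \<mu> v - M i k * (1 + q i) * form k \<nu> v),
        k := v k - ((1 + q i)\<^sup>2 * form k \<nu> v - M k i * (1 + q i) * form i \<mu> v))"
proof -
  let ?S = "\<lambda>x y. v(i := v i - x, k := v k - y)"
  let ?F = "form i \<mu> v" and ?G = "form k \<nu> v" and ?q = "q i" and ?c = "M i k" and ?d = "M k i"
  have s: "refl i \<mu> (?S x y) = ?S x' y" if "?F - ?q * x - ?c * y = x'" for x y x'
    using refl_shift1[OF assms(1-3)] that by simp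
  have t: "refl k \<nu> (?S x y) = ?S x y'" if "?G - ?q * y - ?d * x = y'" for x y y'
    using refl_shift2[OF assms(1-3)] assms(4) that by simp
  \<comment> \<open>One reflection at a time: reducing by \<open>M i k * M k i = 3 * q i\<close>
    after each keeps the two coefficients linear in \<open>?F\<close> and \<open>?G\<close>.\<close>
  have "refl k \<nu> (?S 0 0) = ?S 0 ?G"
    by (rule t) simp
  moreover have "refl i \<mu> (?S 0 ?G) = ?S (?F - ?c * ?G) ?G"
    by (rule s) simp
  moreover have "refl k \<nu> (?S (?F - ?c * ?G) ?G) = ?S (?F - ?c * ?G) ((1 + 2 * ?q) * ?G - ?d * ?F)"
    by (rule t) (use assms(5) in algebra)
  moreover have "refl i \<mu> (?S (?F - ?c * ?G) ((1 + 2 * ?q) * ?G - ?d * ?F))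
      = ?S ((1 + 2 * ?q) * ?F - ?c * (1 + ?q) * ?G) ((1 + 2 * ?q) * ?G - ?d * ?F)"
    by (rule s) (use assms(5) in algebra)
  moreover have "refl k \<nu> (?S ((1 + 2 * ?q) * ?F - ?c * (1 + ?q) * ?G) ((1 + 2 * ?q) * ?G - ?d * ?F))
      = ?S ((1 + 2 * ?q) * ?F - ?c * (1 + ?q) * ?G) ((1 + ?q)\<^sup>2 * ?G - ?d * (1 + ?q) * ?F)"
    by (rule t) (use assms(5) in algebra)
  moreover have "refl i \<mu> (?S ((1 + 2 * ?q) * ?F - ?c * (1 + ?q) * ?G) ((1 + ?q)\<^sup>2 * ?G - ?d * (1 + ?q) * ?F))
      = ?S ((1 + ?q)\<^sup>2 * ?F - ?c * (1 + ?q) * ?G) ((1 + ?q)\<^sup>2 * ?G - ?d * (1 + ?q) * ?F)"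
    by (rule s) (use assms(5) in algebra)
  moreover have "v = ?S 0 0"
    by simp
  ultimately show ?thesis
    by metis
qed

lemma refl_braid6:
  assumes "i \<le> n" "k \<le> n" "i \<noteq> k" "q i = q k" "M i k * M k i = 3 * q i"
  shows "refl i \<mu> (refl k \<nu> (refl i \<mu> (refl k \<nu> (refl i \<mu> (refl k \<nu> v)))))
    = refl k \<nu> (refl i \<mu> (refl k \<nu> (refl i \<mu> (refl k \<nu> (refl i \<mu> v)))))"
proof -
  have "M k i * M i k = 3 * q k"
    using assms(4,5) by (simp add: mult.commute)
  then show ?thesis
    using assms refl_six[OF assms, of \<mu> \<nu> v] refl_six[of k i \<nu> \<mu> v]
    by (simp add: fun_upd_twist)
qed

text \<open>Conjugating the reflection at \<open>i\<close> by the involution at \<open>k\<close>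
  moves its root to one on which the form at \<open>i\<close> vanishes, because
  \<open>1 + q i\<close> equals \<open>M i k * M k i\<close>. The weights may differ since the extra
  coordinate of a root is zero.\<close>

lemma refl_double_lace:
  assumes "i \<le> n" "k \<le> n" "i \<noteq> k" "q k = 1" "M i k * M k i = q i + 1"
  shows "refl k \<nu> (refl i \<mu> (refl k \<nu> (refl i \<mu>' v))) = refl i \<mu>' (refl k \<nu> (refl i \<mu> (refl k \<nu> v)))"
proof -
  let ?S = "\<lambda>x y. v(i := v i - x, k := v k - y)"
  let ?F = "form i \<mu> v" and ?F' = "form i \<mu>' v" and ?G = "form k \<nu> v"
  let ?q = "q i" and ?c = "M i k" and ?d = "M k i"
  have s: "refl i \<kappa> (?S x y) = ?S x' y" if "form i \<kappa> v - ?q * x - ?c * y = x'" for \<kappa> x y x'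
    using refl_shift1[OF assms(1-3)] that by simp
  have t: "refl k \<nu> (?S x y) = ?S x y'" if "?G - y - ?d * x = y'" for x y y'
    using refl_shift2[OF assms(1-3)] assms(4) that by simp
  let ?x = "?F + ?F' - ?c * ?G" and ?y = "(?q + 1) * ?G - ?d * ?F"
  have "refl i \<mu>' (?S 0 0) = ?S ?F' 0"
    by (rule s) simp
  moreover have "refl k \<nu> (?S ?F' 0) = ?S ?F' (?G - ?d * ?F')"
    by (rule t) simp
  moreover have "refl i \<mu> (?S ?F' (?G - ?d * ?F')) = ?S ?x (?G - ?d * ?F')"
    by (rule s) (use assms(5) in algebra)
  moreover have "refl k \<nu> (?S ?x (?G - ?d * ?F')) = ?S ?x ?y"
    by (rule t) (use assms(5) in algebra)
  moreover have "refl k \<nu> (?S 0 0) = ?S 0 ?G"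
    by (rule t) simp
  moreover have "refl i \<mu> (?S 0 ?G) = ?S (?F - ?c * ?G) ?G"
    by (rule s) simp
  moreover have "refl k \<nu> (?S (?F - ?c * ?G) ?G) = ?S (?F - ?c * ?G) ?y"
    by (rule t) (use assms(5) in algebra)
  moreover have "refl i \<mu>' (?S (?F - ?c * ?G) ?y) = ?S ?x ?y"
    by (rule s) (use assms(5) in algebra)
  moreover have "v = ?S 0 0"
    by simp
  ultimately show ?thesis
    by metis
qed

text \<open>Affine reflections share their root and differ only in the weight. Conjugation moves the
  weight \<mu> by the dilation of ratio \<open>- 2\<close> about \<kappa>, whose value is
  \<open>3 * \<kappa> - 2 * \<mu>\<close>; the inverse conjugation uses ratio
  \<open>- 1 / 2\<close>.\<close>

lemma refl_conj: "refl 0 \<kappa> (refl 0 \<mu> v) = refl 0 (3 * \<kappa> - 2 * \<mu>) (refl 0 \<kappa> v)"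
proof -
  have "form 0 \<nu> v = form 0 0 v + \<nu> * v (Suc n)" for \<nu> and v :: "nat \<Rightarrow> real"
    by (simp add: form_def)
  note this[of \<kappa> v] this[of \<mu> v] this[of "3 * \<kappa> - 2 * \<mu>" v]
  then show ?thesis
    by (simp add: refl_def form_upd diag q_affine fun_eq_iff algebra_simps)
qed

lemma refl_inv_conj: "refl_inv 0 \<kappa> (refl 0 \<mu> v) = refl 0 ((3 * \<kappa> - \<mu>) / 2) (refl_inv 0 \<kappa> v)"
proof -
  have "refl 0 \<kappa> (refl 0 ((3 * \<kappa> - \<mu>) / 2) (refl_inv 0 \<kappa> v)) = refl 0 \<mu> v"
    by (subst refl_conj) (simp add: refl_refl_inv[OF le0] diff_divide_distrib)
  from arg_cong[OF this, of "refl_inv 0 \<kappa>"] show ?thesis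
    by (simp only: refl_inv_refl[OF le0])
qed

lemma refl_conj_cancel: "refl 0 \<kappa> (refl 0 \<mu> (refl_inv 0 \<kappa> v)) = refl 0 (3 * \<kappa> - 2 * \<mu>) v"
  by (simp only: refl_conj[of \<kappa> \<mu>] refl_refl_inv[OF le0])

lemma refl_inv_conj_cancel: "refl_inv 0 \<kappa> (refl 0 \<mu> (refl 0 \<kappa> v)) = refl 0 ((3 * \<kappa> - \<mu>) / 2) v"
  by (simp only: refl_inv_conj[of \<kappa> \<mu>] refl_inv_refl[OF le0])

text \<open>The weight is read off from the image of the extra basis vector.\<close>

lemma refl_affine_inj:
  assumes "refl 0 \<mu> = refl 0 \<nu>"
  shows "\<mu> = \<nu>"
  using fun_cong[OF fun_cong[OF assms, of "\<lambda>j. if j = Suc n then 1 else 0"], of 0]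
  by (simp add: refl_def form_def)

section \<open>The action of words and the defining relations of the triple group\<close>

fun weight :: "(nat \<Rightarrow> real) \<Rightarrow> triple_gen \<Rightarrow> real" where
  "weight l (T i) = 0"
| "weight l (T0 c) = l c"

fun letter :: "(nat \<Rightarrow> real) \<Rightarrow> triple_gen \<times> bool \<Rightarrow> (nat \<Rightarrow> real) \<Rightarrow> nat \<Rightarrow> real" where
  "letter l (x, e) = (if e then refl else refl_inv) (node x) (weight l x)"

lemma node_le: "x \<in> triple_gens n \<Longrightarrow> node x \<le> n"
  by (auto simp: triple_gens_def)

lemma letter_cancel: "x \<in> triple_gens n \<Longrightarrow> letter l (x, \<not> e) (letter l (x, e) v) = v"
  by (simp add: node_le refl_inv_refl refl_refl_inv)

lemma letter_rels_a:
  assumes "(u, w) \<in> rels_a n A"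
  shows "fold (letter l) u v = fold (letter l) w v"
proof -
  obtain m x y where uw: "u = alternating m (gen x) (gen y)" "w = alternating m (gen y) (gen x)"
    and xy: "x \<in> triple_gens n" "y \<in> triple_gens n" "node x \<noteq> node y"
    and m: "(laces A (node x) (node y), m) \<in> braid_length"
    using assms by (auto simp: rels_a_def braid_relation_def)
  note le = node_le[OF xy(1)] node_le[OF xy(2)] xy(3)
  consider "laces A (node x) (node y) = 0" "m = 2" | "laces A (node x) (node y) = 1" "m = 3"
    | "laces A (node x) (node y) = 2" "m = 4" | "laces A (node x) (node y) = 3" "m = 6"
    using m by (auto simp: braid_length_def)
  then show ?thesis
  proof cases
    case 1
    then have "M (node x) (node y) = 0" "M (node y) (node x) = 0"
      using laces0[OF le] laces0[OF le(2,1)] le(3) by (auto simp: laces_def)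
    from refl_commute[OF le this] 1 show ?thesis
      by (simp add: uw gen_def numeral_eq_Suc)
  next
    case 2
    with refl_braid3[OF le] laces1[OF le] show ?thesis
      by (simp add: uw gen_def numeral_eq_Suc)
  next
    case 3
    from refl_braid4[OF le laces2[OF le 3(1)]] 3 show ?thesis
      by (simp add: uw gen_def numeral_eq_Suc)
  next
    case 4
    with laces3[OF le] have "q (node x) = q (node y)" "M (node x) (node y) * M (node y) (node x) = 3 * q (node x)"
      by auto
    from refl_braid6[OF le this] 4 show ?thesis
      by (simp add: uw gen_def numeral_eq_Suc)
  qed
qed

text \<open>Words in affine letters permute the affine reflections by conjugation, changing only the
  weight; applied to powers of \<open>D_word\<close>.\<close>

lemma fold_affine_conj:
  assumes "\<And>p. p \<in> set u \<Longrightarrow> \<exists>c. fst p = T0 c"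
  shows "\<exists>\<mu>'. \<forall>v. fold (letter l) u (refl 0 \<mu> v) = refl 0 \<mu>' (fold (letter l) u v)"
  using assms
proof (induction u arbitrary: \<mu>)
  case (Cons p u)
  obtain c e where p: "p = (T0 c, e)"
    using Cons.prems[of p] by (cases p) auto
  have "\<exists>\<mu>'. \<forall>v. letter l p (refl 0 \<mu> v) = refl 0 \<mu>' (letter l p v)"
    using refl_conj refl_inv_conj by (cases e) (auto simp: p)
  then obtain \<mu>1 where 1: "\<And>v. letter l p (refl 0 \<mu> v) = refl 0 \<mu>1 (letter l p v)" by blast
  obtain \<mu>2 where "\<And>v. fold (letter l) u (refl 0 \<mu>1 v) = refl 0 \<mu>2 (fold (letter l) u v)"
    using Cons.IH[of \<mu>1] Cons.prems by auto
  with 1 have "\<forall>v. fold (letter l) (p # u) (refl 0 \<mu> v) = refl 0 \<mu>2 (fold (letter l) (p # u) v)"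
    by (simp del: letter.simps)
  then show ?case by blast
qed auto

lemma letter_rels_b:
  assumes "(u, w) \<in> rels_b n A"
  shows "fold (letter l) u v = fold (letter l) w v"
proof -
  obtain x \<alpha> k where uw: "(u, w) = braid_relation 3 x (wpow D_word k @ gen (T \<alpha>) @ wpow D_word (- k))"
    and x: "x \<in> {gen (T0 1), gen (T0 2), gen (T0 3),
          gen (T0 1) @ gen (T0 2) @ winv (gen (T0 1)),
          winv (gen (T0 3)) @ gen (T0 2) @ gen (T0 3)}"
    and \<alpha>: "\<alpha> \<in> {1..n}" "laces A 0 \<alpha> = 1"
    using assms unfolding rels_b_def by (elim CollectE exE conjE) (rule that)
  define K where "K = fold (letter l) (wpow D_word k)"
  define K' where "K' = fold (letter l) (wpow D_word (- k))"
  \<comment> \<open>Each of the five words acts as a single affine reflection, the two conjugates by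
    the dilation rules.\<close>
  have "\<exists>\<mu>. fold (letter l) x = refl 0 \<mu>"
    using x by (auto simp: gen_def winv_def comp_def refl_conj_cancel refl_inv_conj_cancel)
  then obtain \<mu> where \<mu>: "fold (letter l) x = refl 0 \<mu>" by blast
  have KK': "K (K' v) = v" "K' (K v) = v" for v
    using fold_wpow_minus[of "triple_gens n" "letter l" D_word k]
      fold_wpow_minus[of "triple_gens n" "letter l" D_word "- k"] letter_cancel D_word_in_words
    by (simp_all add: K_def K'_def)
  have "\<exists>c. fst p = T0 c" if "p \<in> set (wpow D_word k)" for p
    using that by (auto simp: wpow_def D_word_def gen_def winv_def set_concat split: if_splits)
  then obtain \<mu>' where \<mu>': "\<And>v. K (refl 0 \<mu> v) = refl 0 \<mu>' (K v)"
    using fold_affine_conj[of "wpow D_word k" l \<mu>] unfolding K_def by blast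
  \<comment> \<open>Moving the affine reflection through \<open>K\<close> and \<open>K'\<close>
    turns the relation into a conjugate of the braid relation between the reflections
    \<open>refl 0 \<mu>'\<close> and \<open>refl \<alpha> 0\<close>.\<close>
  have \<mu>'': "refl 0 \<mu> (K' v) = K' (refl 0 \<mu>' v)" for v
    using arg_cong[OF \<mu>'[of "K' v"], of K'] by (simp only: KK')
  have "refl 0 \<mu> (K' (refl \<alpha> 0 (K (refl 0 \<mu> v)))) = K' (refl 0 \<mu>' (refl \<alpha> 0 (refl 0 \<mu>' (K v))))"
    by (simp only: \<mu>' \<mu>'')
  also have "\<dots> = K' (refl \<alpha> 0 (refl 0 \<mu>' (refl \<alpha> 0 (K v))))"
    using \<alpha> laces1[of 0 \<alpha>] by (subst refl_braid3) auto
  also have "\<dots> = K' (refl \<alpha> 0 (K (refl 0 \<mu> (K' (refl \<alpha> 0 (K v))))))"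
    by (simp only: \<mu>' KK')
  finally show ?thesis
    using uw by (simp add: braid_relation_def numeral_3_eq_3 \<mu> gen_def K_def[symmetric] K'_def[symmetric])
qed

lemma letter_rels_c:
  assumes "(u, w) \<in> rels_c n A"
  shows "fold (letter l) u v = fold (letter l) w v"
proof -
  obtain i j \<alpha> where uw: "u = gen (T0 i) @ winv (gen (T \<alpha>)) @ gen (T0 j) @ gen (T \<alpha>)"
      "w = winv (gen (T \<alpha>)) @ gen (T0 j) @ gen (T \<alpha>) @ gen (T0 i)"
    and \<alpha>: "\<alpha> \<in> {1..n}" "laces A 0 \<alpha> = 2"
    using assms unfolding rels_c_def by auto
  \<comment> \<open>As \<open>q \<alpha> = 1\<close>, the inverse letters in relation c) may be
    replaced by the letters themselves.\<close>
  have "refl_inv \<alpha> \<mu> = refl \<alpha> \<mu>" for \<mu>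
    using q_double[OF \<alpha>] by (simp add: fun_eq_iff refl_def refl_inv_def)
  moreover have "refl \<alpha> \<nu> (refl 0 \<mu> (refl \<alpha> \<nu> (refl 0 \<mu>' v))) = refl 0 \<mu>' (refl \<alpha> \<nu> (refl 0 \<mu> (refl \<alpha> \<nu> v)))"
    for \<mu> \<mu>' \<nu>
    using \<alpha> laces2[of 0 \<alpha>] q_double[OF \<alpha>] by (intro refl_double_lace) auto
  ultimately show ?thesis
    by (simp add: uw gen_def winv_def)
qed

sublocale reflection: word_action "triple_gens n" "triple_rels n A" "letter l" for l
proof
  show "letter l (x, \<not> e) (letter l (x, e) v) = v" if "x \<in> triple_gens n" for x e v
    using that by (rule letter_cancel)
  show "fold (letter l) u v = fold (letter l) w v" if "(u, w) \<in> triple_rels n A" for u w v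
    using that letter_rels_a letter_rels_b letter_rels_c unfolding triple_rels_def by blast
qed (rule triple_rels_in_words)

end

section \<open>The Hurwitz action on the weights of the affine generators\<close>

text \<open>The change of weights dictated by the braid automorphisms: a conjugated generator
  receives the weight given by the dilation rules for conjugate reflections.\<close>

fun hurwitz :: "b3_gen \<times> bool \<Rightarrow> (nat \<Rightarrow> real) \<Rightarrow> nat \<Rightarrow> real" where
  "hurwitz (Letter_a, True) l = l(1 := l 2, 2 := 3 * l 2 - 2 * l 1)"
| "hurwitz (Letter_a, False) l = l(1 := (3 * l 1 - l 2) / 2, 2 := l 1)"
| "hurwitz (Letter_b, True) l = l(2 := l 3, 3 := 3 * l 3 - 2 * l 2)"
| "hurwitz (Letter_b, False) l = l(2 := (3 * l 2 - l 3) / 2, 3 := l 2)"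

text \<open>The Hurwitz action commutes with a common translation of the weights, so it passes to
  their differences, where it is the reduced Burau action.\<close>

definition gaps :: "(nat \<Rightarrow> real) \<Rightarrow> real \<times> real" where
  "gaps l = (l 2 - l 1, l 3 - l 2)"

lemma gaps_hurwitz: "gaps (hurwitz (x, e) l) = burau (x, e) (gaps l)"
  by (cases x; cases e) (simp_all add: gaps_def field_simps)

lemma gaps_fold_hurwitz: "gaps (fold hurwitz w l) = fold burau w (gaps l)"
  by (induction w arbitrary: l) (auto simp: gaps_hurwitz)

section \<open>Elements of the automorphism group as functions\<close>

lemma carrier_AutoGroup: "carrier (AutoGroup G) = auto G"
  by (simp add: AutoGroup_def)

lemma AutoGroup_mult_apply:
  assumes "f \<in> carrier (AutoGroup G)" "g \<in> carrier (AutoGroup G)" "x \<in> carrier G"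
  shows "(f \<otimes>\<^bsub>AutoGroup G\<^esub> g) x = f (g x)"
  using assms by (simp add: AutoGroup_def BijGroup_def auto_def compose_def)

lemma AutoGroup_one_apply: "x \<in> carrier G \<Longrightarrow> \<one>\<^bsub>AutoGroup G\<^esub> x = x"
  by (simp add: AutoGroup_def BijGroup_def)

lemma (in group) AutoGroup_group_hom:
  "f \<in> carrier (AutoGroup G) \<Longrightarrow> group_hom G G f"
  by (auto simp: carrier_AutoGroup auto_def group_hom_def group_hom_axioms_def intro: is_group)

lemma (in group) AutoGroup_inv_apply:
  assumes "f \<in> carrier (AutoGroup G)" "x \<in> carrier G"
  shows "(inv\<^bsub>AutoGroup G\<^esub> f) (f x) = x"
proof -
  interpret Aut: group "AutoGroup G" by (rule AutoGroup)
  show ?thesis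
    using assms AutoGroup_mult_apply[of "inv\<^bsub>AutoGroup G\<^esub> f" G f x] by (simp add: AutoGroup_one_apply)
qed

locale triple_braiding =
  fixes n :: nat and A :: "nat \<Rightarrow> nat \<Rightarrow> int"
    and \<Upsilon> :: "b3_gen word set \<Rightarrow> triple_gen word set \<Rightarrow> triple_gen word set"
  assumes hom: "\<Upsilon> \<in> hom B3 (AutoGroup (triple_group n A))"
    and a: "is_underline_a n A (\<Upsilon> B3_a)"
    and b: "is_underline_b n A (\<Upsilon> B3_b)"
begin

abbreviation G where "G \<equiv> triple_group n A"
abbreviation t where "t c \<equiv> triple_elt n A (T0 c)"

sublocale G: group G
  by (rule group_triple_group)

sublocale \<Upsilon>: group_hom B3 "AutoGroup G" \<Upsilon>
  by (intro group_hom.intro group_hom_axioms.intro hom group_B3 G.AutoGroup)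

lemma t_closed: "c \<in> {1, 2, 3} \<Longrightarrow> t c \<in> carrier G"
  by (auto simp: triple_elt_def triple_group_def triple_gens_def intro: pgen_closed)

lemma t_simps [simp]: "t 1 \<in> carrier G" "t 2 \<in> carrier G" "t 3 \<in> carrier G"
  by (simp_all add: t_closed)

lemma \<Upsilon>_a: "\<Upsilon> B3_a (t 1) = t 2" "\<Upsilon> B3_a (t 2) = inv\<^bsub>G\<^esub> t 2 \<otimes>\<^bsub>G\<^esub> t 1 \<otimes>\<^bsub>G\<^esub> t 2"
    "\<Upsilon> B3_a (t 3) = t 3"
  using a by (simp_all add: is_underline_a_def Let_def)

lemma \<Upsilon>_b: "\<Upsilon> B3_b (t 1) = t 1" "\<Upsilon> B3_b (t 2) = t 3"
    "\<Upsilon> B3_b (t 3) = inv\<^bsub>G\<^esub> t 3 \<otimes>\<^bsub>G\<^esub> t 2 \<otimes>\<^bsub>G\<^esub> t 3"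
  using b by (simp_all add: is_underline_b_def Let_def)

lemma \<Upsilon>_inv_apply:
  assumes "g \<in> carrier B3" "x \<in> carrier G" "\<Upsilon> g x = y"
  shows "\<Upsilon> (inv\<^bsub>B3\<^esub> g) y = x"
  using assms G.AutoGroup_inv_apply[of "\<Upsilon> g" x] by simp

text \<open>Exhibits the preimage of \<open>t c\<close>, from which the values of the inverse
  automorphisms on the affine generators follow.\<close>

lemma conj_image:
  assumes "g \<in> carrier B3" "c \<in> {1, 2, 3}" "d \<in> {1, 2, 3}"
    "\<Upsilon> g (t c) = t d" "\<Upsilon> g (t d) = inv\<^bsub>G\<^esub> t d \<otimes>\<^bsub>G\<^esub> t c \<otimes>\<^bsub>G\<^esub> t d"
  shows "\<Upsilon> g (t c \<otimes>\<^bsub>G\<^esub> t d \<otimes>\<^bsub>G\<^esub> inv\<^bsub>G\<^esub> t c) = t c"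
proof -
  note cl = t_closed[OF assms(2)] t_closed[OF assms(3)]
  interpret f: group_hom G G "\<Upsilon> g"
    using assms(1) by (intro G.AutoGroup_group_hom) simp
  have "\<Upsilon> g (t c \<otimes>\<^bsub>G\<^esub> t d \<otimes>\<^bsub>G\<^esub> inv\<^bsub>G\<^esub> t c)
      = t d \<otimes>\<^bsub>G\<^esub> (inv\<^bsub>G\<^esub> t d \<otimes>\<^bsub>G\<^esub> t c \<otimes>\<^bsub>G\<^esub> t d) \<otimes>\<^bsub>G\<^esub> inv\<^bsub>G\<^esub> t d"
    using cl by (simp add: assms(4,5))
  also have "\<dots> = t d \<otimes>\<^bsub>G\<^esub> (inv\<^bsub>G\<^esub> t d \<otimes>\<^bsub>G\<^esub> t c)"
    using cl by (simp add: G.m_assoc)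
  finally show ?thesis
    using cl by (simp add: G.m_assoc[symmetric])
qed

lemma \<Upsilon>_inv_a: "\<Upsilon> (inv\<^bsub>B3\<^esub> B3_a) (t 1) = t 1 \<otimes>\<^bsub>G\<^esub> t 2 \<otimes>\<^bsub>G\<^esub> inv\<^bsub>G\<^esub> t 1"
    "\<Upsilon> (inv\<^bsub>B3\<^esub> B3_a) (t 2) = t 1" "\<Upsilon> (inv\<^bsub>B3\<^esub> B3_a) (t 3) = t 3"
  using conj_image[of B3_a 1 2] by (simp_all add: \<Upsilon>_inv_apply \<Upsilon>_a del: One_nat_def \<Upsilon>.hom_inv)

lemma \<Upsilon>_inv_b: "\<Upsilon> (inv\<^bsub>B3\<^esub> B3_b) (t 1) = t 1"
    "\<Upsilon> (inv\<^bsub>B3\<^esub> B3_b) (t 2) = t 2 \<otimes>\<^bsub>G\<^esub> t 3 \<otimes>\<^bsub>G\<^esub> inv\<^bsub>G\<^esub> t 2"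
    "\<Upsilon> (inv\<^bsub>B3\<^esub> B3_b) (t 3) = t 2"
  using conj_image[of B3_b 2 3] by (simp_all add: \<Upsilon>_inv_apply \<Upsilon>_b del: One_nat_def \<Upsilon>.hom_inv)

end

locale reflected_braiding = triple_braiding + reflection_data
begin

abbreviation \<rho> where "\<rho> l C \<equiv> reflection.class_act l C"

lemmas \<rho>_mult = reflection.class_act_mult[folded triple_group_def]
lemmas \<rho>_one = reflection.class_act_one[folded triple_group_def]

lemma \<rho>_inv:
  assumes "C \<in> carrier G" "\<rho> l C = refl 0 \<mu>"
  shows "\<rho> l (inv\<^bsub>G\<^esub> C) = refl_inv 0 \<mu>"
proof
  fix v
  have "\<rho> l (inv\<^bsub>G\<^esub> C) (\<rho> l C (refl_inv 0 \<mu> v)) = \<rho> l (C \<otimes>\<^bsub>G\<^esub> inv\<^bsub>G\<^esub> C) (refl_inv 0 \<mu> v)"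
    using assms(1) by (subst \<rho>_mult) simp_all
  then show "\<rho> l (inv\<^bsub>G\<^esub> C) v = refl_inv 0 \<mu> v"
    using assms by (simp add: \<rho>_one refl_refl_inv)
qed

lemma \<rho>_conj:
  assumes "C \<in> carrier G" "D \<in> carrier G" "\<rho> l C = refl 0 \<mu>" "\<rho> l D = refl 0 \<kappa>"
  shows "\<rho> l (inv\<^bsub>G\<^esub> D \<otimes>\<^bsub>G\<^esub> C \<otimes>\<^bsub>G\<^esub> D) = refl 0 (3 * \<kappa> - 2 * \<mu>)"
    and "\<rho> l (C \<otimes>\<^bsub>G\<^esub> D \<otimes>\<^bsub>G\<^esub> inv\<^bsub>G\<^esub> C) = refl 0 ((3 * \<mu> - \<kappa>) / 2)"
  using assms by (intro ext, simp add: \<rho>_mult \<rho>_inv refl_conj_cancel refl_inv_conj_cancel)+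

text \<open>Links the three actions: applying a braid to an affine generator changes the weight of
  its reflection by the Hurwitz action. The induction needs all three generators at once, since
  conjugates mix them.\<close>

lemma \<rho>_\<Upsilon>:
  assumes "w \<in> words UNIV" "c \<in> {1, 2, 3}"
  shows "\<rho> l (\<Upsilon> (word_rel UNIV b3_rels `` {w}) (t c)) = refl 0 (fold hurwitz w l c)"
  using assms
proof (induction w arbitrary: c rule: rev_induct)
  case Nil
  have "word_rel UNIV b3_rels `` {[]} = \<one>\<^bsub>B3\<^esub>"
    by (simp add: B3_def one_presented_group)
  moreover have "T0 c \<in> triple_gens n"
    using Nil by (auto simp: triple_gens_def)
  ultimately show ?case
    using Nil t_closed[of c]
    by (simp add: AutoGroup_one_apply) (simp add: triple_elt_def reflection.class_act_pgen fun_eq_iff)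
next
  case (snoc p w)
  obtain x e where p: "p = (x, e)" by force
  define g where "g = word_rel UNIV b3_rels `` {w}"
  have w: "w \<in> words UNIV"
    using snoc by simp
  have g: "g \<in> carrier B3"
    unfolding g_def B3_def using w by simp
  have h: "word_rel UNIV b3_rels `` {[(x, e)]} \<in> carrier B3"
    unfolding B3_def by simp
  interpret f: group_hom G G "\<Upsilon> g"
    using g by (intro G.AutoGroup_group_hom) simp
  \<comment> \<open>The last letter is applied first to the generator and \<open>g\<close> then
    transforms the resulting conjugate. On weights the last letter therefore acts last, in agreement
    with \<open>fold\<close>.\<close>
  have "\<Upsilon> (word_rel UNIV b3_rels `` {w @ [p]}) (t c) = \<Upsilon> g (\<Upsilon> (word_rel UNIV b3_rels `` {[(x, e)]}) (t c))"
    using t_closed[OF snoc.prems(2)] g h unfolding p B3_snoc[OF w] g_def[symmetric]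
    by (simp add: AutoGroup_mult_apply)
  moreover have IH: "\<rho> l (\<Upsilon> g (t 1)) = refl 0 (fold hurwitz w l 1)"
      "\<rho> l (\<Upsilon> g (t 2)) = refl 0 (fold hurwitz w l 2)"
      "\<rho> l (\<Upsilon> g (t 3)) = refl 0 (fold hurwitz w l 3)"
    using snoc.IH[OF w] unfolding g_def by auto
  ultimately show ?case
    using snoc.prems(2)
    by (cases x; cases e)
      (auto simp: B3_letter p \<Upsilon>_a \<Upsilon>_b \<Upsilon>_inv_a \<Upsilon>_inv_b \<rho>_conj
        simp del: One_nat_def \<Upsilon>.hom_inv)
qed

text \<open>A braid in the kernel fixes the affine generators, hence all weights by
  \<open>refl_affine_inj\<close>, hence all gaps, and so lies in the trivial Burau kernel.\<close>

lemma braiding_faithful: "inj_on \<Upsilon> (carrier B3)"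
proof -
  have "g = \<one>\<^bsub>B3\<^esub>" if g: "g \<in> carrier B3" "\<Upsilon> g = \<one>\<^bsub>AutoGroup G\<^esub>" for g
  proof (rule burau_faithful[OF g(1)])
    fix z :: "real \<times> real"
    obtain w where w: "w \<in> words UNIV" "g = word_rel UNIV b3_rels `` {w}"
      using g(1) unfolding B3_def by (rule word_classE)
    have "fold hurwitz w l c = l c" if c: "c \<in> {1, 2, 3}" for l c
    proof (rule refl_affine_inj)
      have "T0 c \<in> triple_gens n"
        using c by (auto simp: triple_gens_def)
      then have "\<rho> l (t c) = refl 0 (l c)"
        by (simp add: triple_elt_def reflection.class_act_pgen fun_eq_iff)
      then show "refl 0 (fold hurwitz w l c) = refl 0 (l c)"
        using \<rho>_\<Upsilon>[OF w(1) c, of l] g(2) t_closed[OF c]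
        by (simp add: w(2) AutoGroup_one_apply)
    qed
    then have "gaps (fold hurwitz w l) = gaps l" for l
      by (simp add: gaps_def)
    \<comment> \<open>Partial sums starting at 0 give weights whose gaps are the prescribed pair
      \<open>z\<close>.\<close>
    from this[of "\<lambda>c. if c = 2 then fst z else if c = 3 then fst z + snd z else 0"]
    have "fold burau w z = z"
      by (simp add: gaps_fold_hurwitz) (simp add: gaps_def)
    then show "\<beta> g z = z"
      using w by (simp add: burau.class_act_class)
  qed
  then show ?thesis
    by (simp add: \<Upsilon>.inj_on_one_iff)
qed

end

section \<open>Reflection data for affine Cartan matrices\<close>

lemma kac_matrix_sym:
  assumes "\<And>a b p q. (a, b, p, q) \<in> set (edges X) \<Longrightarrow> a = 0 \<or> b = 0 \<Longrightarrow> p = q"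
  shows "kac_matrix X 0 j = kac_matrix X j 0"
proof -
  have "(\<Sum>(a, b, p, q)\<leftarrow>edges X. if (0, j) = (a, b) then p else if (0, j) = (b, a) then q else 0)
      = (\<Sum>(a, b, p, q)\<leftarrow>edges X. if (j, 0) = (a, b) then p else if (j, 0) = (b, a) then q else 0)"
    by (intro arg_cong[of _ _ sum_list] map_cong) (auto dest: assms[of 0, simplified] assms[of _ 0, simplified])
  then show ?thesis
    by (auto simp: kac_matrix_def simp del: prod.inject)
qed

lemma kac_matrix_Cons:
  assumes X: "edges X = (0, 1, p, q) # es"
    and es: "\<And>a b p q. (a, b, p, q) \<in> set es \<Longrightarrow> a \<noteq> 0 \<and> b \<noteq> 0"
  shows "kac_matrix X 0 (Suc j) = (if j = 0 then p else 0)"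
    and "kac_matrix X (Suc j) 0 = (if j = 0 then q else 0)"
proof -
  have "(\<Sum>(a, b, p, q)\<leftarrow>es. if (0, Suc j) = (a, b) then p else if (0, Suc j) = (b, a) then q else 0)
      = (\<Sum>_\<leftarrow>es. 0)"
    using es by (intro arg_cong[of _ _ sum_list] map_cong) fastforce+
  then show "kac_matrix X 0 (Suc j) = (if j = 0 then p else 0)"
    by (simp add: kac_matrix_def X del: prod.inject) simp
  have "(\<Sum>(a, b, p, q)\<leftarrow>es. if (Suc j, 0) = (a, b) then p else if (Suc j, 0) = (b, a) then q else 0)
      = (\<Sum>_\<leftarrow>es. 0)"
    using es by (intro arg_cong[of _ _ sum_list] map_cong) fastforce+
  then show "kac_matrix X (Suc j) 0 = (if j = 0 then q else 0)"
    by (simp add: kac_matrix_def X del: prod.inject) simp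
qed

lemma chain_edge: "(a, b, p, q) \<in> set (chain i j) \<Longrightarrow> i \<le> a \<and> b = Suc a \<and> p = q"
  by (auto simp: chain_def single_def)

lemma square_neq_two: "x * x \<noteq> (2 :: int)"
proof
  assume x: "x * x = 2"
  then have "\<bar>x\<bar> \<noteq> 0" "\<bar>x\<bar> \<noteq> 1"
    by (auto simp: abs_if split: if_splits)
  then have "2 * 2 \<le> \<bar>x\<bar> * \<bar>x\<bar>"
    by (intro mult_mono) auto
  with x show False
    by (simp add: abs_mult_self_eq)
qed

text \<open>If all edges at the affine node are symmetric, their numbers of laces are squares and
  never 2. Otherwise the affine node has node 1 as its only neighbour, joined by two laces, or by
  four when the type is \<open>A2_even 1\<close>.\<close>

lemma affine_node_laces:
  assumes X: "valid_type X"
  shows "(\<forall>j. laces (kac_matrix X) 0 j \<noteq> 2) \<or>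
    (\<forall>j>0. kac_matrix X 0 j = 0 \<or> laces (kac_matrix X) 0 j = 2)"
proof -
  have sym: ?thesis if "\<And>a b p q. (a, b, p, q) \<in> set (edges X) \<Longrightarrow> a = 0 \<or> b = 0 \<Longrightarrow> p = q"
  proof -
    have "kac_matrix X 0 j = kac_matrix X j 0" for j
      by (rule kac_matrix_sym) (rule that)
    then show ?thesis
      using square_neq_two by (simp add: laces_def)
  qed
  have double: ?thesis
    if E: "edges X = (0, 1, p, q) # es" "p * q = 2"
      and es: "\<And>a b p q. (a, b, p, q) \<in> set es \<Longrightarrow> a \<noteq> 0 \<and> b \<noteq> 0" for p q es
  proof -
    have "kac_matrix X 0 (Suc j) = (if j = 0 then p else 0)" "kac_matrix X (Suc j) 0 = (if j = 0 then q else 0)" for j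
      by (rule kac_matrix_Cons[OF E(1)]; erule es)+
    then have "kac_matrix X 0 (Suc j) = 0 \<or> laces (kac_matrix X) 0 (Suc j) = 2" for j
      using E(2) by (simp add: laces_def)
    then show ?thesis
      by (metis gr0_implies_Suc)
  qed
  show ?thesis
  proof (cases X)
    case (A1 l)
    then show ?thesis
      by (intro sym) (auto simp: single_def dest: chain_edge split: if_splits)
  next
    case (A2_even l)
    show ?thesis
    proof (cases "l = 1")
      case True
      then have E: "edges X = (0, 1, -4, -1) # []"
        using A2_even by simp
      have "laces (kac_matrix X) 0 (Suc j) \<noteq> 2" for j
        using kac_matrix_Cons[OF E] by (simp add: laces_def split: if_splits)
      moreover have "laces (kac_matrix X) 0 0 \<noteq> 2"
        by (simp add: laces_def kac_matrix_def)
      ultimately show ?thesis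
        by (metis not0_implies_Suc)
    next
      case False
      with A2_even X have "edges X = (0, 1, -2, -1) # chain 1 (l - 1) @ [(l - 1, l, -2, -1)]" "l \<ge> 2"
        by auto
      then show ?thesis
        by (elim double) (auto dest: chain_edge)
    qed
  next
    case (D2 l)
    then have "edges X = (0, 1, -2, -1) # chain 1 (l - 1) @ [(l - 1, l, -1, -2)]" "l \<ge> 2"
      using X by auto
    then show ?thesis
      by (elim double) (auto dest: chain_edge)
  next
    case (C1 l)
    then have "edges X = (0, 1, -1, -2) # chain 1 (l - 1) @ [(l - 1, l, -2, -1)]" "l \<ge> 2"
      using X by auto
    then show ?thesis
      by (elim double) (auto dest: chain_edge)
  qed (use X in \<open>intro sym; auto simp: single_def dest: chain_edge\<close>)+
qed

text \<open>With all parameters equal to 2, the products \<open>M i j * M j i\<close> must be twice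
  the number of laces; doubling the entries above the diagonal achieves this.\<close>

lemma reflection_data_uniform:
  assumes "generalized_cartan_matrix n A" "\<And>\<alpha>. \<alpha> \<in> {1..n} \<Longrightarrow> laces A 0 \<alpha> \<noteq> 2"
  shows "reflection_data n A (\<lambda>i j. if i = j then 3 else of_int (A i j) * (if i < j then 2 else 1)) (\<lambda>_. 2)"
proof -
  let ?M = "\<lambda>i j. if i = j then 3 else of_int (A i j) * (if i < j then 2 else 1) :: real"
  have M: "?M i j * ?M j i = 2 * of_int (laces A i j)" if "i \<noteq> j" for i j
    using that by (auto simp: laces_def)
  show ?thesis
  proof
    fix i j assume ij: "i \<le> n" "j \<le> n" "i \<noteq> j"
    show "?M i j = 0" if "laces A i j = 0"
      using that ij assms(1) by (auto simp: generalized_cartan_matrix_def laces_def)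
    show "2 = (2 :: real) \<and> ?M i j * ?M j i = 2" if "laces A i j = 1"
      unfolding M[OF ij(3)] using that by simp
    show "?M i j * ?M j i = 2 + 2" if "laces A i j = 2"
      unfolding M[OF ij(3)] using that by simp
    show "2 = (2 :: real) \<and> ?M i j * ?M j i = 3 * 2" if "laces A i j = 3"
      unfolding M[OF ij(3)] using that by simp
  qed (use assms(2) in auto)
qed

text \<open>With a double lace at the affine node, relation c) forces the ordinary reflections to be involutions.\<close>

lemma reflection_data_double:
  assumes gcm: "generalized_cartan_matrix n A"
    and double: "\<And>j. 0 < j \<Longrightarrow> j \<le> n \<Longrightarrow> A 0 j = 0 \<or> laces A 0 j = 2"
  shows "reflection_data n A
    (\<lambda>i j. if i = j then (if i = 0 then 3 else 2) else if i = 0 then 3 / 2 * of_int (A i j) else of_int (A i j))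
    (\<lambda>i. if i = 0 then 2 else 1)"
proof -
  have zero: "A i j = 0" if "i \<le> n" "j \<le> n" "i \<noteq> j" "laces A i j = 0" for i j
    using that gcm by (auto simp: generalized_cartan_matrix_def laces_def)
  have affine: "laces A 0 j = 0 \<or> laces A 0 j = 2" if "j \<noteq> 0" "j \<le> n" for j
    using double[of j] that by (auto simp: laces_def)
  have affine': "laces A j 0 = 0 \<or> laces A j 0 = 2" if "j \<noteq> 0" "j \<le> n" for j
    using affine[OF that] by (simp add: laces_def mult.commute)
  \<comment> \<open>The parameters are 2 at the affine node and 1 elsewhere. A double lace at the
    affine node thus needs the product 3, obtained by scaling row 0 by 3/2; the other off-diagonal
    entries are those of the Cartan matrix.\<close>
  let ?M = "\<lambda>i j. if i = j then (if i = 0 then 3 else 2)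
    else if i = 0 then 3 / 2 * of_int (A i j) else of_int (A i j) :: real"
  have M: "?M i j * ?M j i = (if i = 0 \<or> j = 0 then 3 / 2 else 1) * of_int (laces A i j)" if "i \<noteq> j" for i j
    using that by (auto simp: laces_def)
  show ?thesis
  proof
    fix i j assume ij: "i \<le> n" "j \<le> n" "i \<noteq> j"
    \<comment> \<open>Single and triple laces avoid the affine node, so both of their ends carry
      parameter 1.\<close>
    have one: "i \<noteq> 0 \<and> j \<noteq> 0" if "laces A i j \<noteq> 0" "laces A i j \<noteq> 2"
      using ij that affine[of j] affine'[of i] by (cases "i = 0"; cases "j = 0") auto
    show "?M i j = 0" if "laces A i j = 0"
      using zero[OF ij that] ij by auto
    show "(if i = 0 then 2 else 1 :: real) = (if j = 0 then 2 else 1) \<and> ?M i j * ?M j i = (if i = 0 then 2 else 1)"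
      if "laces A i j = 1"
      unfolding M[OF ij(3)] using one that by simp
    show "?M i j * ?M j i = (if i = 0 then 2 else 1) + (if j = 0 then 2 else 1)" if "laces A i j = 2"
      unfolding M[OF ij(3)] using ij(3) that by simp
    show "(if i = 0 then 2 else 1 :: real) = (if j = 0 then 2 else 1) \<and> ?M i j * ?M j i = 3 * (if i = 0 then 2 else 1)"
      if "laces A i j = 3"
      unfolding M[OF ij(3)] using one that by simp
  qed auto
qed

theorem theorem4p10:
  fixes n :: nat
    and A :: "nat \<Rightarrow> nat \<Rightarrow> int"
    and X :: affine_type
    and \<Upsilon> :: "b3_gen word set \<Rightarrow> triple_gen word set \<Rightarrow> triple_gen word set"
  assumes "irreducible_affine_cartan_matrix n A"
    and "kac_labelled n A X"
    and "\<And>l. X \<noteq> B1 l" "\<And>l. X \<noteq> C1 l" "X \<noteq> F4_1" "X \<noteq> G2_1"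
    and "\<Upsilon> \<in> hom B3 (AutoGroup (triple_group n A))"
    and "is_underline_a n A (\<Upsilon> B3_a)"
    and "is_underline_b n A (\<Upsilon> B3_b)"
  shows "inj_on \<Upsilon> (carrier B3)"
proof -
  have gcm: "generalized_cartan_matrix n A"
    using assms(1) by (simp add: irreducible_affine_cartan_matrix_def)
  have X: "valid_type X" and A: "\<And>i j. i \<le> n \<Longrightarrow> j \<le> n \<Longrightarrow> A i j = kac_matrix X i j"
    using assms(2) by (auto simp: kac_labelled_def)
  have laces: "laces A 0 j = laces (kac_matrix X) 0 j" if "j \<le> n" for j
    using that by (simp add: laces_def A)
  \<comment> \<open>Without double laces at the affine node a uniform parameter 2 works; otherwise
    all its neighbours are joined to it by double laces and the parameters 2 and 1 are used.\<close>
  obtain M q where "reflection_data n A M q"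
    using affine_node_laces[OF X]
  proof
    assume "\<forall>j. laces (kac_matrix X) 0 j \<noteq> 2"
    then have "laces A 0 \<alpha> \<noteq> 2" if "\<alpha> \<in> {1..n}" for \<alpha>
      using that by (simp add: laces)
    from reflection_data_uniform[OF gcm this] show ?thesis
      by (rule that)
  next
    assume "\<forall>j>0. kac_matrix X 0 j = 0 \<or> laces (kac_matrix X) 0 j = 2"
    then have "A 0 j = 0 \<or> laces A 0 j = 2" if "0 < j" "j \<le> n" for j
      using that by (simp add: laces A)
    from reflection_data_double[OF gcm this] show ?thesis
      by (rule that)
  qed
  then interpret reflected_braiding n A \<Upsilon> M q
    using assms(7-9) by (simp add: reflected_braiding_def triple_braiding_def)
  show ?thesis
    by (rule braiding_faithful)
qed

end
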